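(* Let $d\ge2$ and $\frac{d+1}2<p<\frac{d+2}2$. Let $f=\sum_{n\ge0}a_nY_n$ on $\mathbb{S}^d$, where for some constant $C$ and all $n\ge1$ $$|a_n|\le\frac{C}{n^p},\qquad|a_n-a_{n-1}|\le\frac{C}{n^{p+1}}.$$ Then $f\in\mathcal{Z}^{p-\frac12-\epsilon}(\mathbb{S}^d)$ for every $\epsilon>0$. Moreover, if $u$ denotes the local solution, on $[0,T)$, of the cubic nonlinear Schrödinger equation $$i\partial_tu+\Delta_{\mathbb{S}^d}u\pm|u|^2u=0,\qquad u(\cdot,0)=f$$ (either sign), then for almost every $t\in(0,T)$ the fractal dimensions of the graphs of $\operatorname{Re}u(\cdot,t)$ and $\operatorname{Im}u(\cdot,t)$ are both at most $$(d+1)-\left(p-\tfrac d2\right).$$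
   Context: $Y_n$ is the zonal harmonic of degree $n$ on $\mathbb{S}^d$ about a fixed pole: the function of the polar angle $\theta\in[0,\pi]$ that is a positive multiple of the Jacobi polynomial $P_n^{(\frac{d-2}2,\frac{d-2}2)}(\cos\theta)$, normalized by $\frac1{\omega_d}\int_{\mathbb{S}^d}Y_n^2\,d\sigma=1$ ($\sigma$ surface measure, $\omega_d=\sigma(\mathbb{S}^d)$); $\Delta_{\mathbb{S}^d}Y_n=-n(n+d-1)Y_n$. $\mathcal{Z}^s(\mathbb{S}^d)=\{f\in H^s(\mathbb{S}^d): f=\sum_na_nY_n\}$ with $\|f\|_{H^s}^2=\sum_n(1+n^2)^{s}|a_n|^2$. For $s>\frac{d-2}2$ the cubic NLS is locally well-posed in $\mathcal Z^s(\mathbb S^d)$ with existence time $T=T(\|f\|_{H^s})>0$; the solution $u\in C([0,T),H^s)$ is zonal. The fractal (upper Minkowski) dimension of a bounded set $E$ is $\limsup_{\epsilon\to0}\frac{\log\mathcal N(E,\epsilon)}{\log(1/\epsilon)}$, where $\mathcal N(E,\epsilon)$ is the minimum number of boxes of sidelength $\epsilon$ needed to cover $E$. *)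

theory Defs
  imports "HOL-Analysis.Analysis"
begin

text \<open>
  The sphere of dimension \<open>d\<close> is \<^term>\<open>sphere 0 1\<close> in a Euclidean space of dimension \<open>d + 1\<close>.
  Functions on it are functions on the ambient space of which only the values on the sphere matter.
\<close>

text \<open>
  Polar coordinates: the surface measure of \<open>A\<close> is \<open>d + 1\<close> times the volume of the cone
  \<open>{r x | 0 < r \<le> 1, x \<in> A}\<close>.  Recall \<open>sgn x = x /\<^sub>R norm x\<close>.
\<close>

definition surface_measure :: "'a::euclidean_space measure" where
  "surface_measure =
     scale_measure (ennreal (real DIM('a)))
       (distr (restrict_space lborel (cball 0 1 - {0})) (restrict_space borel (sphere 0 1)) sgn)"

definition sphere_area :: "'a::euclidean_space itself \<Rightarrow> real" where
  "sphere_area _ = measure (surface_measure :: 'a measure) (sphere 0 1)"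

definition jacobi_poly :: "real \<Rightarrow> real \<Rightarrow> nat \<Rightarrow> real \<Rightarrow> real" where
  "jacobi_poly \<alpha> \<beta> n x =
     (\<Sum>k\<le>n. ((real n + \<alpha>) gchoose (n - k)) * ((real n + \<beta>) gchoose k)
            * ((x - 1) / 2) ^ k * ((x + 1) / 2) ^ (n - k))"

text \<open>
  Here \<open>(d - 2) / 2 = (DIM('a) - 3) / 2\<close>, and \<open>x \<bullet> e\<close> is the cosine of the polar angle of \<open>x\<close>
  measured from the pole \<open>e\<close>.
\<close>

definition zonal_jacobi :: "'a::euclidean_space \<Rightarrow> nat \<Rightarrow> 'a \<Rightarrow> real" where
  "zonal_jacobi e n x =
     jacobi_poly ((real DIM('a) - 3) / 2) ((real DIM('a) - 3) / 2) n (x \<bullet> e)"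

definition zonal_harmonic :: "'a::euclidean_space \<Rightarrow> nat \<Rightarrow> 'a \<Rightarrow> real" where
  "zonal_harmonic e n x =
     zonal_jacobi e n x /
       sqrt ((1 / sphere_area TYPE('a)) * (\<integral>y. (zonal_jacobi e n y)\<^sup>2 \<partial>surface_measure))"

definition sphere_L2 :: "('a::euclidean_space \<Rightarrow> complex) \<Rightarrow> bool" where
  "sphere_L2 f \<longleftrightarrow> f \<in> borel_measurable surface_measure
                  \<and> integrable surface_measure (\<lambda>x. (cmod (f x))\<^sup>2)"

text \<open>\<open>f = (\<Sum>n. a n * Y n)\<close>, with convergence in \<open>L\<^sup>2\<close>.\<close>

definition zonal_expansion ::
    "'a::euclidean_space \<Rightarrow> (nat \<Rightarrow> complex) \<Rightarrow> ('a \<Rightarrow> complex) \<Rightarrow> bool" where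
  "zonal_expansion e a f \<longleftrightarrow> sphere_L2 f \<and>
     (\<lambda>N. \<integral>x. (cmod (f x - (\<Sum>n\<le>N. a n * of_real (zonal_harmonic e n x))))\<^sup>2 \<partial>surface_measure)
       \<longlonglongrightarrow> 0"

text \<open>
  For \<open>s < 0\<close> the Sobolev space also contains distributions; the set below consists of
  its elements that are square-integrable functions.  For \<open>s \<ge> 0\<close> there are no others.
\<close>

definition zonal_sobolev :: "'a::euclidean_space \<Rightarrow> real \<Rightarrow> ('a \<Rightarrow> complex) set" where
  "zonal_sobolev e s =
     {f. \<exists>a. zonal_expansion e a f \<and>
             summable (\<lambda>n. (1 + (real n)\<^sup>2) powr s * (cmod (a n))\<^sup>2)}"

text \<open>
  The harmonics are orthonormal for the normalized surface measure, so the coefficients of an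
  expansion are the Fourier coefficients.
\<close>

definition zonal_coeff :: "'a::euclidean_space \<Rightarrow> ('a \<Rightarrow> complex) \<Rightarrow> nat \<Rightarrow> complex" where
  "zonal_coeff e f n =
     of_real (1 / sphere_area TYPE('a)) *
       (\<integral>x. f x * of_real (zonal_harmonic e n x) \<partial>surface_measure)"

definition sobolev_norm :: "'a::euclidean_space \<Rightarrow> real \<Rightarrow> ('a \<Rightarrow> complex) \<Rightarrow> real" where
  "sobolev_norm e s f = sqrt (\<Sum>n. (1 + (real n)\<^sup>2) powr s * (cmod (zonal_coeff e f n))\<^sup>2)"

primrec Ck_on :: "nat \<Rightarrow> 'a::euclidean_space set \<Rightarrow> ('a \<Rightarrow> real) \<Rightarrow> bool" where
  "Ck_on 0 S f = continuous_on S f"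
| "Ck_on (Suc k) S f =
     ((\<forall>x\<in>S. f differentiable (at x)) \<and> (\<forall>v. Ck_on k S (\<lambda>x. frechet_derivative f (at x) v)))"

text \<open>
  \<open>\<phi> \<circ> sgn\<close> is the extension of \<open>\<phi>\<close> from the sphere that is constant along rays.
  The function \<open>\<phi>\<close> is smooth on the sphere iff this extension is smooth away from the origin,
  and its Laplace-Beltrami operator is then the Euclidean Laplacian of the extension,
  evaluated on the sphere.
\<close>

definition smooth_on_sphere :: "('a::euclidean_space \<Rightarrow> real) \<Rightarrow> bool" where
  "smooth_on_sphere \<phi> \<longleftrightarrow> (\<forall>k. Ck_on k (- {0}) (\<phi> \<circ> sgn))"

definition euclidean_laplacian :: "('a::euclidean_space \<Rightarrow> real) \<Rightarrow> 'a \<Rightarrow> real" where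
  "euclidean_laplacian g x =
     (\<Sum>b\<in>Basis. frechet_derivative (\<lambda>y. frechet_derivative g (at y) b) (at x) b)"

definition laplace_beltrami :: "('a::euclidean_space \<Rightarrow> real) \<Rightarrow> 'a \<Rightarrow> real" where
  "laplace_beltrami \<phi> = euclidean_laplacian (\<phi> \<circ> sgn)"

text \<open>
  \<open>u\<close> solves \<open>i u\<^sub>t + \<Delta> u + \<mu> |u|\<^sup>2 u = 0\<close> in \<open>C([0,T), H\<^sup>s)\<close> with data \<open>f\<close>.  The equation is
  understood in the sense of distributions on the sphere, for each time (one-sided at time \<open>0\<close>).
  The notion is meant for \<open>s > d / 2\<close>.  Then every element of \<open>H\<^sup>s\<close> agrees almost everywhere
  with exactly one continuous function on the sphere, and this is the representative
  \<open>u t\<close> is required to be; the cubic term is then an honest function as well.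
\<close>

definition nls_solution ::
    "'a::euclidean_space \<Rightarrow> real \<Rightarrow> real \<Rightarrow> real \<Rightarrow> ('a \<Rightarrow> complex) \<Rightarrow> (real \<Rightarrow> 'a \<Rightarrow> complex) \<Rightarrow> bool"
where
  "nls_solution e \<mu> s T f u \<longleftrightarrow>
     (\<forall>t\<in>{0..<T}. u t \<in> zonal_sobolev e s \<and> continuous_on (sphere 0 1) (u t)) \<and>
     (\<forall>t0\<in>{0..<T}. ((\<lambda>t. sobolev_norm e s (\<lambda>x. u t x - u t0 x)) \<longlongrightarrow> 0) (at t0 within {0..<T})) \<and>
     (AE x in surface_measure. u 0 x = f x) \<and>
     (\<forall>\<phi>. smooth_on_sphere \<phi> \<longrightarrow>
       (\<forall>t\<in>{0..<T}. \<exists>D.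
          ((\<lambda>\<tau>. \<integral>x. u \<tau> x * of_real (\<phi> x) \<partial>surface_measure) has_vector_derivative D)
             (at t within {0..<T}) \<and>
          \<i> * D + (\<integral>x. u t x * of_real (laplace_beltrami \<phi> x) \<partial>surface_measure)
            + of_real \<mu> * (\<integral>x. of_real ((cmod (u t x))\<^sup>2) * u t x * of_real (\<phi> x) \<partial>surface_measure)
            = 0))"

definition box_covering_number :: "'b::euclidean_space set \<Rightarrow> real \<Rightarrow> nat" where
  "box_covering_number E \<epsilon> =
     (LEAST k. \<exists>A. finite A \<and> card A = k \<and> E \<subseteq> (\<Union>a\<in>A. cbox a (a + \<epsilon> *\<^sub>R One)))"

definition fractal_dim :: "'b::euclidean_space set \<Rightarrow> ereal" where
  "fractal_dim E =
     Limsup (at_right 0) (\<lambda>\<epsilon>. ereal (ln (real (box_covering_number E \<epsilon>)) / ln (1 / \<epsilon>)))"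

definition sphere_graph :: "('a::euclidean_space \<Rightarrow> real) \<Rightarrow> ('a \<times> real) set" where
  "sphere_graph g = (\<lambda>x. (x, g x)) ` sphere 0 1"

end

theory Submission
  imports Defs
begin

text \<open>
  The equation plays no role: \<open>u t\<close> is a continuous zonal function in \<open>H\<^sup>s\<close> with \<open>s > d / 2 \<ge> 1\<close>, and
  the graph of any continuous zonal function \<open>g\<close> in \<open>H\<^sup>1\<close> has dimension at most \<open>d\<close>, which is less than
  \<open>(d + 1) - (p - d / 2)\<close>.  Indeed, cut the sphere into \<open>m\<close> zones of width \<open>\<eta> = \<pi> / m\<close> in the polar
  angle.  The \<open>k\<close>-th zone has radius about \<open>\<kappa>\<^sub>k \<eta>\<close> with \<open>\<kappa>\<^sub>k = min (k + 1) (m - k)\<close>, so the graph over it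
  is covered by about \<open>\<kappa>\<^sub>k\<^sup>d\<^sup>-\<^sup>1 (1 + osc\<^sub>k g / \<eta>)\<close> boxes of side comparable to \<open>\<eta>\<close>.  As \<open>g\<close> depends on the
  polar angle only, \<open>\<Sum>\<^sub>k (\<kappa>\<^sub>k \<eta>)\<^sup>d\<^sup>-\<^sup>1 osc\<^sub>k g\<close> is bounded by the integral of \<open>\<bar>g'(\<theta>)\<bar> sin\<^sup>d\<^sup>-\<^sup>1 \<theta>\<close>, that is by
  the \<open>L\<^sup>1\<close> norm of the gradient, and the total is \<open>O (\<eta>\<^sup>-\<^sup>d)\<close>.

  The gradient is controlled by the coefficients through the Jacobi differential equation.  To pass from
  the surface measure to the weight \<open>sin\<^sup>d\<^sup>-\<^sup>1 \<theta> d\<theta>\<close> it suffices to compare integrals of powers of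
  \<open>cos \<theta>\<close>, and these satisfy the same two-term recursion for both.
\<close>

section \<open>Integration over the sphere\<close>

text \<open>The partial sums of the expansion converge in L^2, not pointwise, so the gradient bound
  for polynomials reaches \<open>g\<close> only along an almost everywhere convergent subsequence.
  The extrema of \<open>g\<close> over a zone must therefore be moved to nearby points of
  convergence, possibly in an adjacent zone; this is why the oscillation estimate works with tripled
  zones. Near the poles the weight sin^(d-1) degenerates and the gradient no longer controls the
  oscillation. The two zones at either pole have \<open>\<kappa>\<close> at most 2, however, so the
  sup bound of \<open>g\<close> is enough there. The exponent d - 1 of \<open>\<kappa>\<close> is
  the dimension of the equator: a net of mesh 1/\<kappa> on it, shrunk to radius at most \<kappa>
  \<eta>, has mesh at most \<eta>. Since \<open>surface_measure\<close> is defined by volumes of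
  cones, comparing moments replaces a change of variables: Lebesgue scaling, Fubini and translation
  invariance suffice. In the vector field behind the recursion, 2 is the least integer power of the
  positive part of 1 - |x|^2 that is C^1 across the sphere, so no boundary term arises.\<close>

lemma measurable_sgn_sphere:
  "(sgn :: 'a::euclidean_space \<Rightarrow> 'a) \<in>
     restrict_space lborel (cball 0 1 - {0}) \<rightarrow>\<^sub>M restrict_space borel (sphere 0 1)"
proof (rule measurable_restrict_space2)
  show "(sgn :: 'a \<Rightarrow> 'a) \<in> space (restrict_space lborel (cball 0 1 - {0})) \<rightarrow> sphere 0 1"
    by (auto simp: space_restrict_space norm_sgn)
  show "(sgn :: 'a \<Rightarrow> 'a) \<in> restrict_space lborel (cball 0 1 - {0}) \<rightarrow>\<^sub>M borel"
    unfolding sgn_div_norm by (intro measurable_restrict_space1) simp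
qed

lemma borel_measurable_sgn_euclidean [measurable]: "(sgn :: 'a::euclidean_space \<Rightarrow> 'a) \<in> borel_measurable borel"
  unfolding sgn_div_norm by simp

text \<open>Scaling by a constant is a constant density, the form in which Bochner integrals against
  the measure unfold.\<close>

lemma surface_measure_eq_density:
  "(surface_measure :: 'a::euclidean_space measure) =
     density (distr (restrict_space lborel (cball 0 1 - {0})) (restrict_space borel (sphere 0 1)) sgn)
       (\<lambda>_. ennreal (real DIM('a)))"
  unfolding surface_measure_def
  by (rule measure_eqI) (simp_all add: emeasure_density_const)

lemma sets_surface_measure: "sets surface_measure = sets (restrict_space borel (sphere 0 1))"
  by (simp add: surface_measure_def)

lemma space_surface_measure [simp]: "space surface_measure = sphere 0 1"
  by (simp add: surface_measure_def space_scale_measure space_restrict_space)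

lemma borel_measurable_surface_measure:
  "h \<in> borel_measurable borel \<Longrightarrow> h \<in> borel_measurable surface_measure"
  using measurable_cong_sets[OF sets_surface_measure refl] measurable_restrict_space1 by blast

lemma emeasure_surface_measure:
  assumes "A \<in> sets (surface_measure :: 'a::euclidean_space measure)"
  shows "emeasure surface_measure A =
    ennreal (real DIM('a)) * emeasure lborel (sgn -` A \<inter> (cball 0 1 - {0}))"
proof -
  have A: "A \<in> sets (restrict_space borel (sphere 0 1))"
    using assms sets_surface_measure by blast
  have "emeasure surface_measure A = ennreal (real DIM('a)) *
     emeasure (restrict_space lborel (cball 0 1 - {0})) (sgn -` A \<inter> (cball 0 1 - {0}))"
    unfolding surface_measure_def emeasure_scale_measure
    by (subst emeasure_distr[OF measurable_sgn_sphere A]) (simp add: space_restrict_space)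
  also have "emeasure (restrict_space lborel (cball 0 1 - {0})) (sgn -` A \<inter> (cball 0 1 - {0}))
     = emeasure lborel (sgn -` A \<inter> (cball 0 1 - {0}))"
    by (rule emeasure_restrict_space) auto
  finally show ?thesis .
qed

lemma finite_measure_surface_measure: "finite_measure (surface_measure :: 'a::euclidean_space measure)"
proof
  have "emeasure lborel (sgn -` sphere 0 1 \<inter> (cball 0 1 - {0}) :: 'a set) \<le> emeasure lborel (cball 0 1 :: 'a set)"
    by (intro emeasure_mono) auto
  also have "\<dots> < \<infinity>" using emeasure_lborel_cball_finite by (simp add: less_top[symmetric])
  finally have "emeasure lborel (sgn -` sphere 0 1 \<inter> (cball 0 1 - {0}) :: 'a set) \<noteq> \<infinity>" by simp
  moreover have "sphere 0 1 \<in> sets (surface_measure :: 'a measure)"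
    using sets.top[of "surface_measure :: 'a measure"] by simp
  ultimately show "emeasure (surface_measure :: 'a measure) (space surface_measure) \<noteq> \<infinity>"
    by (simp add: emeasure_surface_measure ennreal_mult_eq_top_iff)
qed

lemma integral_surface_measure:
  fixes h :: "'a::euclidean_space \<Rightarrow> real"
  assumes [measurable]: "h \<in> borel_measurable borel"
  shows "(\<integral>x. h x \<partial>surface_measure) =
     real DIM('a) * (LINT x:cball 0 1|lborel. h (sgn x))"
proof -
  have h: "h \<in> borel_measurable (restrict_space borel (sphere 0 1))"
    by (intro measurable_restrict_space1) simp
  have "(\<integral>x. h x \<partial>surface_measure) = (\<integral>x. real DIM('a) * h (sgn x) \<partial>restrict_space lborel (cball 0 1 - {0}))"
    unfolding surface_measure_eq_density
    by (subst integral_density) (use h measurable_sgn_sphere in \<open>auto simp: integral_distr[OF measurable_sgn_sphere h]\<close>)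
  also have "\<dots> = real DIM('a) * (LINT x:cball 0 1 - {0}|lborel. h (sgn x))"
  proof -
    have "(\<integral>x. real DIM('a) * h (sgn x) \<partial>restrict_space lborel (cball 0 1 - {0})) =
      real DIM('a) * (\<integral>x. h (sgn x) \<partial>restrict_space lborel (cball 0 1 - {0}))"
      by (rule integral_mult_right_zero)
    then show ?thesis
      by (simp add: integral_restrict_space set_lebesgue_integral_def)
  qed
  \<comment> \<open>The puncture at the origin, where \<open>sgn\<close> leaves the sphere, is a
    Lebesgue null set.\<close>
  also have "(LINT x:cball 0 1 - {0}|lborel. h (sgn x)) = (LINT x:cball 0 1|lborel. h (sgn x))"
    unfolding set_lebesgue_integral_def
  proof (rule integral_cong_AE)
    have "AE x in lborel. x \<noteq> (0::'a)" by (rule AE_lborel_singleton)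
    then show "AE x in lborel. indicat_real (cball 0 1 - {0}) x *\<^sub>R h (sgn x) = indicat_real (cball 0 1) x *\<^sub>R h (sgn x)"
      by eventually_elim (simp add: indicator_def)
    have [measurable]: "indicat_real (cball (0::'a) 1) \<in> borel_measurable borel"
      "indicat_real (cball (0::'a) 1 - {0}) \<in> borel_measurable borel"
      by (intro borel_measurable_indicator; simp)+
    show "(\<lambda>x. indicat_real (cball 0 1 - {0}) x *\<^sub>R h (sgn x)) \<in> borel_measurable lborel"
      "(\<lambda>x. indicat_real (cball 0 1) x *\<^sub>R h (sgn x)) \<in> borel_measurable lborel"
      by measurable
  qed
  finally show ?thesis .
qed

text \<open>If \<open>P\<close> failed on a whole neighbourhood of the point in the sphere, the open
  cone over that neighbourhood would lie in a Lebesgue null set; yet it contains a ball around half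
  the point.\<close>

lemma AE_surface_measure_dense:
  fixes x\<^sub>0 :: "'a::euclidean_space"
  assumes "AE x in surface_measure. P x" "x\<^sub>0 \<in> sphere 0 1" "0 < \<delta>"
  shows "\<exists>x\<in>sphere 0 1. P x \<and> dist x x\<^sub>0 < \<delta>"
proof (rule ccontr)
  assume contra: "\<not> ?thesis"
  obtain N where N: "{x \<in> space surface_measure. \<not> P x} \<subseteq> N" "emeasure surface_measure N = 0"
    "N \<in> sets (surface_measure :: 'a measure)"
    using assms(1) by (rule AE_E)
  let ?U = "{x. x \<noteq> 0 \<and> norm x < 1 \<and> sgn x \<in> ball x\<^sub>0 \<delta>} :: 'a set"
  have sub: "?U \<subseteq> sgn -` N \<inter> (cball 0 1 - {0})"
    using contra N(1) by (force simp: dist_commute norm_sgn)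
  have zero: "emeasure lborel (sgn -` N \<inter> (cball 0 1 - {0})) = 0"
    using N(2) emeasure_surface_measure[OF N(3)] by simp
  have m: "sgn -` N \<inter> (cball 0 1 - {0}) \<in> sets lborel"
  proof -
    have N': "N \<in> sets (restrict_space borel (sphere 0 1))"
      using N(3) sets_surface_measure by blast
    show ?thesis
      using measurable_sets[OF measurable_sgn_sphere N']
      by (simp add: space_restrict_space sets_restrict_space_iff)
  qed
  have U0: "emeasure lborel B = 0" if "B \<subseteq> ?U" for B
  proof -
    have "emeasure lborel B \<le> emeasure lborel (sgn -` N \<inter> (cball 0 1 - {0}))"
      by (rule emeasure_mono) (use that sub m in blast)+
    with zero show ?thesis by simp
  qed
  have "open ({x. x \<noteq> 0 \<and> norm x < 1} :: 'a set)"
    by (intro open_Collect_conj open_Collect_neq open_Collect_less continuous_intros)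
  moreover have "continuous_on {x :: 'a. x \<noteq> 0 \<and> norm x < 1} sgn"
    by (auto intro!: continuous_intros simp: sgn_div_norm[abs_def])
  ultimately have "open ({x :: 'a. x \<noteq> 0 \<and> norm x < 1} \<inter> sgn -` ball x\<^sub>0 \<delta>)"
    by (intro continuous_open_preimage) auto
  moreover have "{x :: 'a. x \<noteq> 0 \<and> norm x < 1} \<inter> sgn -` ball x\<^sub>0 \<delta> = ?U" by auto
  moreover have "(1/2) *\<^sub>R x\<^sub>0 \<in> ?U" using assms(2,3) by (auto simp: sgn_div_norm)
  ultimately obtain r where r: "r > 0" "ball ((1/2) *\<^sub>R x\<^sub>0) r \<subseteq> ?U"
    by (metis (no_types, lifting) open_contains_ball)
  have "measure lborel (ball ((1/2) *\<^sub>R x\<^sub>0) r) = 0" using U0[OF r(2)] by (simp add: measure_def)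
  then show False using content_ball_pos[OF r(1), of "(1/2) *\<^sub>R x\<^sub>0"] by simp
qed

section \<open>Radial scaling and the divergence theorem\<close>

text \<open>The integrand is constant along rays, so dilating the ball only contributes the
  Jacobian.\<close>

lemma set_integral_sgn_cball:
  fixes h :: "'a::euclidean_space \<Rightarrow> real"
  assumes [measurable]: "h \<in> borel_measurable borel" and "0 \<le> r"
  shows "(LINT x:cball 0 r|lborel. h (sgn x)) = r ^ DIM('a) * (LINT x:cball 0 1|lborel. h (sgn x))"
proof (cases "r = 0")
  case True
  have "AE x in lborel. indicat_real (cball 0 0) (x::'a) *\<^sub>R h (sgn x) = 0"
    using AE_lborel_singleton[of "0::'a"] by eventually_elim (simp add: indicator_def)
  then have "(LINT x:cball 0 0|lborel. h (sgn x)) = 0"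
    unfolding set_lebesgue_integral_def by (rule integral_eq_zero_AE)
  then show ?thesis using True by (simp add: zero_power)
next
  case False
  with assms have r: "r > 0" by simp
  have "(LINT x:cball 0 r|lborel. h (sgn x)) =
    (\<integral>x. indicator (cball 0 r) x * h (sgn x) \<partial>density (distr lborel borel (\<lambda>x. 0 + r *\<^sub>R x)) (\<lambda>_. \<bar>r\<bar>^DIM('a)))"
    unfolding set_lebesgue_integral_def using lborel_affine[of r "0::'a"] r by simp
  also have "\<dots> = (\<integral>x. r ^ DIM('a) * (indicator (cball 0 r) (r *\<^sub>R x) * h (sgn (r *\<^sub>R x))) \<partial>lborel)"
  proof -
    have [measurable]: "(\<lambda>x. indicat_real (cball 0 r) x * h (sgn x)) \<in> borel_measurable borel"
      by (intro borel_measurable_times borel_measurable_indicator) auto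
    show ?thesis using r by (subst integral_density) (simp_all add: integral_distr)
  qed
  also have "\<dots> = r ^ DIM('a) * (LINT x:cball 0 1|lborel. h (sgn x))"
    unfolding set_lebesgue_integral_def using r
    by (auto simp: indicator_def sgn_scaleR intro!: arg_cong[where f="\<lambda>y. _ * y"] Bochner_Integration.integral_cong)
  finally show ?thesis .
qed

text \<open>With n = DIM the factor n / (n + j) is the quotient of the integrals of r^(n-1+j) and
  r^(n-1) over [0,1]. It is obtained by writing 1 - |x|^j as the integral of j r^(j-1) over [|x|, 1]
  and applying Fubini: for fixed \<open>r\<close> the inner integral runs over the ball of radius
  \<open>r\<close> and is known by scaling.\<close>

lemma set_integral_norm_power_sgn:
  fixes h :: "'a::euclidean_space \<Rightarrow> real"
  assumes [measurable]: "h \<in> borel_measurable borel" and B: "\<And>x. \<bar>h x\<bar> \<le> B"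
  shows "(LINT x:cball 0 1|lborel. norm x ^ j * h (sgn x)) =
    real DIM('a) / (real DIM('a) + real j) * (LINT x:cball 0 1|lborel. h (sgn x))"
proof (cases j)
  case 0
  then show ?thesis by simp
next
  case (Suc i)
  let ?f = "\<lambda>(x::'a) (r::real). indicat_real (cball 0 1) x * h (sgn x) *
     (indicator {norm x..1} r * (real (Suc i) * r ^ i))"
  let ?n = "real DIM('a)" and ?I = "LINT x:cball 0 1|lborel. h (sgn x)"
  have B0: "B \<ge> 0" using B[of 0] by linarith
  have ind: "indicat_real {norm x..1} r = (if norm x \<le> r \<and> r \<le> 1 then 1 else 0)" for x :: 'a and r
    by (auto simp: indicator_def)
  have "case_prod ?f \<in> borel_measurable (borel \<Otimes>\<^sub>M borel)"
  proof -
    have [measurable]: "indicat_real (cball (0::'a) 1) \<in> borel_measurable borel"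
      by (intro borel_measurable_indicator) auto
    show ?thesis unfolding ind by measurable
  qed
  then have m: "case_prod ?f \<in> borel_measurable (lborel \<Otimes>\<^sub>M lborel)"
    by (simp cong: measurable_cong_sets sets_pair_measure_cong)
  have fin: "emeasure (lborel \<Otimes>\<^sub>M lborel) (cball (0::'a) 1 \<times> {0..1::real}) < \<infinity>"
    unfolding lborel_prod using emeasure_compact_finite[of "cball (0::'a) 1 \<times> {0..1::real}"]
    by (simp add: compact_Times less_top)
  have int: "integrable (lborel \<Otimes>\<^sub>M lborel) (case_prod ?f)"
  proof (rule integrableI_bounded_set[where A = "cball 0 1 \<times> {0..1}" and B = "B * real (Suc i)"])
    show "cball (0::'a) 1 \<times> {0..1::real} \<in> sets (lborel \<Otimes>\<^sub>M lborel)" by (simp add: pair_measureI)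
    have "\<bar>?f x r\<bar> \<le> B * real (Suc i)" for x r
    proof -
      have pw: "\<bar>r ^ i\<bar> \<le> 1" if "norm x \<le> r" "r \<le> 1"
        using that norm_ge_zero[of x] by (intro power_le_one order_trans[OF _ that(1)]
            | simp add: power_abs abs_of_nonneg order_trans[OF norm_ge_zero that(1)])+
      have "\<bar>?f x r\<bar> \<le> 1 * B * (1 * (real (Suc i) * 1))" if "norm x \<le> r" "r \<le> 1"
        unfolding abs_mult using that norm_ge_zero[of x]
        by (intro mult_mono) (auto simp: B indicator_def B0 pw simp del: of_nat_Suc)
      then show ?thesis using B0 by (cases "norm x \<le> r \<and> r \<le> 1") (auto simp: ind)
    qed
    then show "AE x\<in>cball 0 1 \<times> {0..1} in lborel \<Otimes>\<^sub>M lborel. norm (case_prod ?f x) \<le> B * real (Suc i)"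
      by (auto simp: case_prod_unfold simp del: of_nat_Suc)
    have "case_prod ?f x = 0" if "x \<notin> cball 0 1 \<times> {0..1}" for x
      using that norm_ge_zero[of "fst x"] unfolding case_prod_unfold ind
      by (cases "norm (fst x) \<le> snd x \<and> snd x \<le> 1") (auto simp: mem_Times_iff indicator_def)
    then show "AE x in lborel \<Otimes>\<^sub>M lborel. x \<notin> cball 0 1 \<times> {0..1} \<longrightarrow> case_prod ?f x = 0"
      by blast
  qed (use m fin in auto)
  have inner: "(\<integral>r. ?f x r \<partial>lborel) = indicat_real (cball 0 1) x * ((1 - norm x ^ j) * h (sgn x))" for x
  proof (cases "norm x \<le> 1")
    case True
    have "((\<lambda>y. y ^ Suc i) has_real_derivative real (Suc i) * y ^ i) (at y)" for y :: real
      using DERIV_pow[of "Suc i" y] by simp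
    then have "(\<integral>r. (real (Suc i) * r ^ i) * indicator {norm x..1} r \<partial>lborel) = 1 ^ Suc i - norm x ^ Suc i"
      using True by (intro integral_FTC_Icc_real) (auto intro!: continuous_intros)
    moreover have "(\<integral>r. ?f x r \<partial>lborel) =
        (\<integral>r. h (sgn x) * ((real (Suc i) * r ^ i) * indicator {norm x..1} r) \<partial>lborel)"
      using True by (intro Bochner_Integration.integral_cong) simp_all
    ultimately show ?thesis using True Suc by (simp add: mult.commute del: of_nat_Suc)
  qed simp
  have L: "(\<integral>x. (\<integral>r. ?f x r \<partial>lborel) \<partial>lborel) = (LINT x:cball 0 1|lborel. (1 - norm x ^ j) * h (sgn x))"
    unfolding inner set_lebesgue_integral_def real_scaleR_def ..
  have "(\<integral>x. ?f x r \<partial>lborel) = ?I * (real (Suc i) * r ^ (DIM('a) + i) * indicator {0..1} r)" for r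
  proof (cases "0 \<le> r \<and> r \<le> 1")
    case True
    have "(\<integral>x. ?f x r \<partial>lborel) = (\<integral>x. (real (Suc i) * r ^ i) * (indicator (cball 0 r) x *\<^sub>R h (sgn x)) \<partial>lborel)"
      using True by (intro Bochner_Integration.integral_cong) (auto simp: ind indicator_def)
    also have "\<dots> = (real (Suc i) * r ^ i) * (r ^ DIM('a) * ?I)"
      using set_integral_sgn_cball[of h r] True by (simp add: set_lebesgue_integral_def)
    finally show ?thesis using True by (simp add: power_add)
  next
    case False
    then have "?f x r = 0" for x
      using order_trans[OF norm_ge_zero, of x r] unfolding ind by auto
    then have "(\<integral>x. ?f x r \<partial>lborel) = 0"
      by (intro integral_eq_zero_AE AE_I2) blast
    then show ?thesis using False by (auto simp: indicator_def)
  qed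
  then have R: "(\<integral>r. (\<integral>x. ?f x r \<partial>lborel) \<partial>lborel) =
      ?I * (\<integral>r. real (Suc i) * r ^ (DIM('a) + i) * indicator {0..1} r \<partial>lborel)"
    by simp
  have "((\<lambda>y. real (Suc i) / (?n + real (Suc i)) * y ^ (DIM('a) + Suc i)) has_real_derivative real (Suc i) * y ^ (DIM('a) + i)) (at y)" for y :: real
    by (rule derivative_eq_intros refl | simp add: divide_simps)+
  then have "(\<integral>r. real (Suc i) * r ^ (DIM('a) + i) * indicator {0..1} r \<partial>lborel) =
     real (Suc i) / (?n + real (Suc i)) * 1 ^ (DIM('a) + Suc i) - real (Suc i) / (?n + real (Suc i)) * 0 ^ (DIM('a) + Suc i)"
    by (intro integral_FTC_Icc_real) (auto intro!: continuous_intros)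
  with R have R: "(\<integral>r. (\<integral>x. ?f x r \<partial>lborel) \<partial>lborel) = real j / (?n + real j) * ?I"
    by (simp add: Suc)
  have bd: "integrable lborel (\<lambda>x. indicat_real (cball 0 1) x *\<^sub>R g x)"
    if [measurable]: "g \<in> borel_measurable borel" and "\<And>x. norm x \<le> 1 \<Longrightarrow> \<bar>g x\<bar> \<le> B" for g :: "'a \<Rightarrow> real"
    by (rule integrableI_bounded_set_indicator[where B = B])
      (use that emeasure_lborel_cball_finite[of "0::'a" 1] in auto)
  have b: "\<bar>norm x ^ j * h (sgn x)\<bar> \<le> B" if "norm x \<le> 1" for x
    using mult_mono[of "norm x ^ j" 1 "\<bar>h (sgn x)\<bar>" B] that B[of "sgn x"] by (simp add: abs_mult power_le_one)
  have "(\<integral>x. indicat_real (cball 0 1) x *\<^sub>R h (sgn x) - indicat_real (cball 0 1) x *\<^sub>R (norm x ^ j * h (sgn x)) \<partial>lborel) =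
      ?I - (LINT x:cball 0 1|lborel. norm x ^ j * h (sgn x))"
    unfolding set_lebesgue_integral_def
    by (intro Bochner_Integration.integral_diff bd) (use b B in auto)
  then have "(LINT x:cball 0 1|lborel. (1 - norm x ^ j) * h (sgn x)) = ?I - (LINT x:cball 0 1|lborel. norm x ^ j * h (sgn x))"
    unfolding set_lebesgue_integral_def by (simp add: algebra_simps)
  with lborel_pair.Fubini_integral[OF int] L R
  have "(LINT x:cball 0 1|lborel. norm x ^ j * h (sgn x)) = ?I - real j / (?n + real j) * ?I" by simp
  also have "\<dots> = ?n / (?n + real j) * ?I"
  proof -
    have "?n + real j \<noteq> 0" using DIM_positive[where 'a = 'a] by linarith
    then show ?thesis by (simp add: divide_simps) (simp add: algebra_simps)
  qed
  finally show ?thesis .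
qed

text \<open>Only the kink at 0 needs an argument: there the difference quotient is itself the
  positive part, up to the sign regime, and tends to 0. This makes the cut-off field of the
  divergence theorem differentiable across the unit sphere.\<close>

lemma has_real_derivative_positive_part_square:
  "((\<lambda>y::real. (max 0 y)\<^sup>2) has_real_derivative 2 * max 0 y) (at y)"
proof (cases y "0 :: real" rule: linorder_cases)
  case less
  have "((\<lambda>y::real. 0) has_real_derivative 2 * max 0 y) (at y)" using less by simp
  then show ?thesis
    by (rule has_field_derivative_transform_within_open[where S = "{..<0}"]) (use less in auto)
next
  case greater
  have "((\<lambda>y::real. y\<^sup>2) has_real_derivative 2 * max 0 y) (at y)"
    using greater by (auto intro!: derivative_eq_intros)
  then show ?thesis
    by (rule has_field_derivative_transform_within_open[where S = "{0<..}"]) (use greater in auto)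
next
  case equal
  have "((\<lambda>h. max 0 h) \<longlongrightarrow> max 0 (0::real)) (at 0)"
    by (intro tendsto_intros)
  then have "((\<lambda>h::real. max 0 h) \<longlongrightarrow> 0) (at 0)" by simp
  then have "((\<lambda>h::real. (max 0 h)\<^sup>2 / h) \<longlongrightarrow> 0) (at 0)"
    by (rule Lim_transform_eventually)
      (auto simp: eventually_at_filter max_def power2_eq_square intro!: always_eventually)
  then show ?thesis
    using equal by (simp add: DERIV_def)
qed

text \<open>Translation invariance of Lebesgue measure makes every difference quotient of
  \<open>F\<close> along \<open>v\<close> integrate to 0. The mean value theorem bounds the
  quotients by \<open>B\<close>, and their supports stay in one ball, so dominated convergence
  passes to the derivative.\<close>

lemma integral_directional_derivative_eq_0:
  fixes F D :: "'a::euclidean_space \<Rightarrow> real" and v :: 'a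
  assumes [measurable]: "F \<in> borel_measurable borel" "D \<in> borel_measurable borel"
    and deriv: "\<And>x s. ((\<lambda>s. F (x + s *\<^sub>R v)) has_real_derivative D (x + s *\<^sub>R v)) (at s)"
    and supp: "\<And>x. norm x > R \<Longrightarrow> F x = 0 \<and> D x = 0"
    and bound: "\<And>x. \<bar>F x\<bar> \<le> B \<and> \<bar>D x\<bar> \<le> B"
  shows "(\<integral>x. D x \<partial>lborel) = 0"
proof -
  define q where "q n x = real (Suc n) * (F (x + (1 / real (Suc n)) *\<^sub>R v) - F x)" for n x
  have B: "B \<ge> 0" using bound[of 0] by linarith
  have F: "integrable lborel F"
    by (rule integrableI_bounded_set[where A = "cball 0 R" and B = B])
      (use supp bound emeasure_lborel_cball_finite in \<open>auto simp: not_le\<close>)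
  have trans: "distr lborel borel (\<lambda>x. x + c) = lborel" for c :: 'a
    using lborel_distr_plus[of c] by (subst add.commute)
  have Fc: "integrable lborel (\<lambda>x. F (x + c)) \<and> (\<integral>x. F (x + c) \<partial>lborel) = (\<integral>x. F x \<partial>lborel)" for c
  proof -
    have "integrable (distr lborel borel (\<lambda>x. x + c)) F" using F trans by simp
    then have "integrable lborel (\<lambda>x. F (x + c))" by (simp add: integrable_distr_eq)
    moreover have "(\<integral>x. F x \<partial>lborel) = (\<integral>x. F x \<partial>distr lborel borel (\<lambda>x. x + c))" using trans by simp
    ultimately show ?thesis by (simp add: integral_distr)
  qed
  have q0: "(\<integral>x. q n x \<partial>lborel) = 0" for n
    unfolding q_def using Fc[of "(1 / real (Suc n)) *\<^sub>R v"] F by simp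
  have lim: "(\<lambda>n. q n x) \<longlonglongrightarrow> D x" for x
  proof -
    have "((\<lambda>h. (F (x + h *\<^sub>R v) - F x) / h) \<longlongrightarrow> D x) (at 0)"
      using deriv[of x 0] by (simp add: DERIV_def)
    moreover have "filterlim (\<lambda>n. 1 / real (Suc n)) (at 0) sequentially"
      by (rule filterlim_atI) (use LIMSEQ_Suc[OF lim_1_over_n] in auto)
    ultimately have "(\<lambda>n. (F (x + (1 / real (Suc n)) *\<^sub>R v) - F x) / (1 / real (Suc n))) \<longlonglongrightarrow> D x"
      by (rule filterlim_compose)
    then show ?thesis by (simp add: q_def mult.commute)
  qed
  have qb: "\<bar>q n x\<bar> \<le> B" for n x
  proof -
    let ?h = "1 / real (Suc n)"
    have "\<exists>z. 0 < z \<and> z < ?h \<and> F (x + ?h *\<^sub>R v) - F (x + 0 *\<^sub>R v) = (?h - 0) * D (x + z *\<^sub>R v)"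
      by (rule MVT2) (use deriv in auto)
    then obtain z where "F (x + ?h *\<^sub>R v) - F x = ?h * D (x + z *\<^sub>R v)" by auto
    then have "q n x = D (x + z *\<^sub>R v)" by (simp add: q_def del: of_nat_Suc)
    with bound show ?thesis by simp
  qed
  have q_supp: "q n x = 0" if "x \<notin> cball 0 (R + norm v)" for n x
  proof -
    have "R < norm x" using that norm_ge_zero[of v] unfolding mem_cball dist_0_norm by linarith
    moreover have "R < norm (x + (1 / real (Suc n)) *\<^sub>R v)"
    proof -
      have "norm ((1 / real (Suc n)) *\<^sub>R v) \<le> norm v"
        by (simp add: field_simps mult_left_le)
      then show ?thesis using that norm_diff_ineq[of x "(1 / real (Suc n)) *\<^sub>R v"] by simp
    qed
    ultimately show ?thesis using supp by (simp add: q_def)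
  qed
  have "(\<lambda>n. \<integral>x. q n x \<partial>lborel) \<longlonglongrightarrow> (\<integral>x. D x \<partial>lborel)"
  proof (rule integral_dominated_convergence[where w = "\<lambda>x. indicator (cball 0 (R + norm v)) x * B"])
    show "integrable lborel (\<lambda>x. indicat_real (cball 0 (R + norm v)) x * B)"
      by (intro integrable_mult_left integrable_real_indicator emeasure_lborel_cball_finite) simp
    show "AE x in lborel. norm (q n x) \<le> indicat_real (cball 0 (R + norm v)) x * B" for n
      using qb q_supp by (auto simp: indicator_def simp del: mem_cball intro!: AE_I2)
    show "q n \<in> borel_measurable lborel" for n unfolding q_def by measurable
  qed (use lim in auto)
  then show ?thesis by (simp add: q0 LIMSEQ_const_iff)
qed

text \<open>
  The divergence theorem for the vector field \<open>(1 - |x|\<^sup>2)\<^sub>+\<^sup>2 (x \<bullet> e)\<^sup>k e\<close>, in polar coordinates.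
\<close>

lemma surface_moment_recursion:
  fixes e :: "'a::euclidean_space"
  assumes "norm e = 1"
  shows "(real DIM('a) - 1 + real k) * (\<integral>x. (x \<bullet> e) ^ Suc k \<partial>surface_measure) =
    real k * (\<integral>x. (x \<bullet> e) ^ (k - 1) \<partial>surface_measure)"
proof -
  let ?n = "real DIM('a)"
  define m where "m i = (LINT x:cball 0 1|lborel. (sgn x \<bullet> e) ^ i)" for i
  define \<psi> where "\<psi> x = max 0 (1 - x \<bullet> x)" for x :: 'a
  \<comment> \<open>The derivative of \<psi>^2 (x \<bullet> e)^k along \<open>e\<close>, as \<psi>
    has derivative -2 (x \<bullet> e) inside the ball. For k = 0 the truncated exponent k - 1 is
    harmless, its factor \<open>real k\<close> being 0.\<close>
  define D where "D x = - 4 * \<psi> x * (x \<bullet> e) ^ Suc k + real k * (\<psi> x)\<^sup>2 * (x \<bullet> e) ^ (k - 1)" for x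
  have [measurable]: "\<psi> \<in> borel_measurable borel" unfolding \<psi>_def by measurable
  have n1: "?n \<ge> 1" by (simp add: Suc_leI)
  have \<psi>1: "norm x > 1 \<Longrightarrow> \<psi> x = 0" "0 \<le> \<psi> x" "\<psi> x \<le> 1" for x
    using one_less_power[of "norm x" 2] by (auto simp: \<psi>_def dot_square_norm)
  have pw: "\<bar>(x \<bullet> e) ^ i\<bar> \<le> 1" if "norm x \<le> 1" for x i
    using that Cauchy_Schwarz_ineq2[of x e] assms by (simp add: power_abs power_le_one)
  have D0: "(\<integral>x. D x \<partial>lborel) = 0"
  proof (rule integral_directional_derivative_eq_0[where F = "\<lambda>x. (\<psi> x)\<^sup>2 * (x \<bullet> e) ^ k"
        and v = e and R = 1 and B = "4 + real k"])
    show "((\<lambda>s. (\<psi> (x + s *\<^sub>R e))\<^sup>2 * ((x + s *\<^sub>R e) \<bullet> e) ^ k) has_real_derivative D (x + s *\<^sub>R e)) (at s)" for x s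
    proof -
      have ee: "e \<bullet> e = 1" using assms by (simp add: dot_square_norm)
      have "((\<lambda>s. 1 - (x + s *\<^sub>R e) \<bullet> (x + s *\<^sub>R e)) has_real_derivative - 2 * ((x + s *\<^sub>R e) \<bullet> e)) (at s)"
        using ee by (auto simp: algebra_simps inner_commute intro!: derivative_eq_intros)
      from DERIV_chain2[OF has_real_derivative_positive_part_square this]
      have 1: "((\<lambda>s. (\<psi> (x + s *\<^sub>R e))\<^sup>2) has_real_derivative 2 * \<psi> (x + s *\<^sub>R e) * (- 2 * ((x + s *\<^sub>R e) \<bullet> e))) (at s)"
        by (simp add: \<psi>_def)
      have 2: "((\<lambda>s. (x + s *\<^sub>R e) \<bullet> e) has_real_derivative 1) (at s)"
        using ee by (auto simp: inner_add_left intro!: derivative_eq_intros)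
      show ?thesis
        by (rule DERIV_cong[OF DERIV_mult[OF 1 DERIV_power[OF 2, of k]]])
          (simp add: D_def power2_eq_square)
    qed
    show "norm x > 1 \<Longrightarrow> (\<psi> x)\<^sup>2 * (x \<bullet> e) ^ k = 0 \<and> D x = 0" for x
      by (simp add: \<psi>1 D_def)
    show "\<bar>(\<psi> x)\<^sup>2 * (x \<bullet> e) ^ k\<bar> \<le> 4 + real k \<and> \<bar>D x\<bar> \<le> 4 + real k" for x
    proof (cases "norm x \<le> 1")
      case True
      have "\<bar>(\<psi> x)\<^sup>2 * (x \<bullet> e) ^ k\<bar> \<le> 1 * 1"
        unfolding abs_mult by (intro mult_mono) (use \<psi>1[of x] pw[OF True] in \<open>auto simp: power_le_one\<close>)
      moreover have "\<bar>4 * \<psi> x * (x \<bullet> e) ^ Suc k\<bar> \<le> (4 * 1) * 1"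
        unfolding abs_mult[of "4 * \<psi> x"] by (intro mult_mono) (use \<psi>1[of x] pw[OF True, of "Suc k"] in auto)
      moreover have "\<bar>real k * (\<psi> x)\<^sup>2 * (x \<bullet> e) ^ (k - 1)\<bar> \<le> (real k * 1) * 1"
        unfolding abs_mult by (intro mult_mono) (use \<psi>1[of x] pw[OF True] in \<open>auto simp: power_le_one\<close>)
      ultimately show ?thesis by (auto simp: D_def abs_le_iff)
    qed (simp add: \<psi>1 D_def)
  qed (unfold D_def, measurable)
  define M where "M j i = (LINT x:cball 0 1|lborel. norm x ^ j * (sgn x \<bullet> e) ^ i)" for j i
  have M: "M j i = ?n / (?n + real j) * m i" for j i
    unfolding M_def m_def
  proof -
    \<comment> \<open>\<open>set_integral_norm_power_sgn\<close> asks for a function bounded on the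
      whole space. Truncation provides one without changing the values at vectors of norm at most 1,
      hence at any \<open>sgn x\<close>.\<close>
    let ?h = "\<lambda>x. max (- 1) (min 1 ((x \<bullet> e) ^ i))"
    have "?h (sgn x) = (sgn x \<bullet> e) ^ i" for x :: 'a
      using pw[of "sgn x" i] by (cases "x = 0"; cases i) (auto simp: norm_sgn abs_le_iff)
    with set_integral_norm_power_sgn[of ?h 1 j]
    show "(LINT x:cball 0 1|lborel. norm x ^ j * (sgn x \<bullet> e) ^ i) =
      ?n / (?n + real j) * (LINT x:cball 0 1|lborel. (sgn x \<bullet> e) ^ i)" by simp
  qed
  have int: "integrable lborel (\<lambda>x. indicat_real (cball 0 1) x * (norm x ^ j * (sgn x \<bullet> e) ^ i))" for j i
    unfolding real_scaleR_def[symmetric]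
  proof (rule integrableI_bounded_set_indicator[where B = 1])
    show "AE x\<in>cball 0 1 in lborel. norm (norm x ^ j *\<^sub>R (sgn x \<bullet> e) ^ i) \<le> 1"
      using pw[of "sgn _" i] by (auto simp: abs_mult norm_sgn intro!: AE_I2 mult_le_one power_le_one)
  qed (use emeasure_lborel_cball_finite[of "0::'a" 1] in auto)
  have comb: "(\<integral>x. - 4 * f1 x + 4 * f2 x + c * f3 x - 2 * c * f4 x + c * f5 x \<partial>lborel) =
      - 4 * (\<integral>x. f1 x \<partial>lborel) + 4 * (\<integral>x. f2 x \<partial>lborel) + c * (\<integral>x. f3 x \<partial>lborel)
      - 2 * c * (\<integral>x. f4 x \<partial>lborel) + c * (\<integral>x. f5 x \<partial>lborel)"
    if "integrable lborel f1" "integrable lborel f2" "integrable lborel f3" "integrable lborel f4"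
      "integrable lborel f5" for f1 f2 f3 f4 f5 :: "'a \<Rightarrow> real" and c :: real
    using that by simp
  have polar: "(x \<bullet> e) ^ i = norm x ^ i * (sgn x \<bullet> e) ^ i" for x :: 'a and i
    by (cases "x = 0") (auto simp: sgn_div_norm power_mult_distrib[symmetric] mult.assoc[symmetric])
  \<comment> \<open>Substituting \<psi> = 1 - |x|^2 and expanding leaves only products of a power of
    |x| and a power of \<open>sgn x \<bullet> e\<close>, whose integrals are the
    \<open>M j i\<close>.\<close>
  have "D x = indicat_real (cball 0 1) x *
     (- 4 * (norm x ^ (k + 1) * (sgn x \<bullet> e) ^ Suc k) + 4 * (norm x ^ (k + 3) * (sgn x \<bullet> e) ^ Suc k)
      + real k * (norm x ^ (k - 1) * (sgn x \<bullet> e) ^ (k - 1)) - 2 * real k * (norm x ^ (k + 1) * (sgn x \<bullet> e) ^ (k - 1))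
      + real k * (norm x ^ (k + 3) * (sgn x \<bullet> e) ^ (k - 1)))" for x
  proof (cases "norm x \<le> 1")
    case True
    then have \<psi>: "\<psi> x = 1 - norm x ^ 2"
      by (simp add: \<psi>_def dot_square_norm power_le_one)
    show ?thesis unfolding D_def \<psi> polar[of x]
      by (cases k) (use True in \<open>auto simp: algebra_simps power2_eq_square numeral_eq_Suc\<close>)
  qed (simp add: D_def \<psi>1)
  then have "(\<integral>x. D x \<partial>lborel) = (\<integral>x. - 4 * (indicat_real (cball 0 1) x * (norm x ^ (k + 1) * (sgn x \<bullet> e) ^ Suc k))
      + 4 * (indicat_real (cball 0 1) x * (norm x ^ (k + 3) * (sgn x \<bullet> e) ^ Suc k))
      + real k * (indicat_real (cball 0 1) x * (norm x ^ (k - 1) * (sgn x \<bullet> e) ^ (k - 1)))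
      - 2 * real k * (indicat_real (cball 0 1) x * (norm x ^ (k + 1) * (sgn x \<bullet> e) ^ (k - 1)))
      + real k * (indicat_real (cball 0 1) x * (norm x ^ (k + 3) * (sgn x \<bullet> e) ^ (k - 1))) \<partial>lborel)"
    by (intro Bochner_Integration.integral_cong) (simp_all add: algebra_simps)
  also have "\<dots> = - 4 * M (k + 1) (Suc k) + 4 * M (k + 3) (Suc k)
      + real k * M (k - 1) (k - 1) - 2 * real k * M (k + 1) (k - 1) + real k * M (k + 3) (k - 1)"
    unfolding M_def set_lebesgue_integral_def real_scaleR_def
    by (rule comb[OF int int int int int])
  finally have eq: "4 * (M (k + 1) (Suc k) - M (k + 3) (Suc k)) =
      real k * (M (k - 1) (k - 1) - 2 * M (k + 1) (k - 1) + M (k + 3) (k - 1))"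
    using D0 by (simp add: algebra_simps)
  have main: "(?n - 1 + real k) * m (Suc k) = real k * m (k - 1)"
  proof (cases k)
    case 0
    \<comment> \<open>For k = 0 the identity equates two different multiples of the first moment,
      which therefore vanishes.\<close>
    have "?n / (?n + 3) < ?n / (?n + 1)" using n1 by (intro divide_strict_left_mono) auto
    then show ?thesis using eq 0 by (simp add: M left_diff_distrib[symmetric])
  next
    case (Suc i)
    \<comment> \<open>This is n + k - 1. All radial denominators become x, x + 2 and x + 4, and
      first and second differences of 1/x yield the common factor 8 n / ((x + 2) (x + 4)) that
      cancels.\<close>
    define x where "x = ?n + real i"
    have x: "x \<ge> 1" using n1 of_nat_0_le_iff[of i] unfolding x_def by linarith
    have a: "?n + real (k + 1) = x + 2" "?n + real (k + 3) = x + 4" "?n + real (k - 1) = x" "?n - 1 + real k = x"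
      using Suc by (auto simp: x_def)
    have c1: "?n / (x + 2) - ?n / (x + 4) = 2 * ?n / ((x + 2) * (x + 4))"
      using x by (simp add: field_simps)
    have c2: "?n / x - 2 * (?n / (x + 2)) + ?n / (x + 4) = 8 * ?n / (x * (x + 2) * (x + 4))"
      using x by (simp add: divide_simps) (simp add: algebra_simps)
    have "4 * ((?n / (x + 2) - ?n / (x + 4)) * m (Suc k)) =
       real k * ((?n / x - 2 * (?n / (x + 2)) + ?n / (x + 4)) * m (k - 1))"
      using eq unfolding M a by (simp only: algebra_simps)
    then have "4 * (2 * ?n / ((x + 2) * (x + 4)) * m (Suc k)) =
       real k * (8 * ?n / (x * (x + 2) * (x + 4)) * m (k - 1))"
      unfolding c1 c2 .
    then have "(8 * ?n / ((x + 2) * (x + 4))) * m (Suc k) =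
       (8 * ?n / ((x + 2) * (x + 4))) * (real k * m (k - 1) / x)"
      by (simp add: mult.assoc mult.left_commute)
    moreover have "8 * ?n / ((x + 2) * (x + 4)) \<noteq> 0" using x n1 by simp
    ultimately have "m (Suc k) = real k * m (k - 1) / x"
      using mult_left_cancel by blast
    then show ?thesis unfolding a using x by simp
  qed
  have "(\<integral>x. (x \<bullet> e) ^ i \<partial>surface_measure) = ?n * m i" for i
    unfolding m_def by (rule integral_surface_measure) measurable
  then show ?thesis using main by (simp only: mult.left_commute[of _ ?n])
qed

section \<open>Gegenbauer polynomials\<close>

definition jacobi_coeff :: "real \<Rightarrow> nat \<Rightarrow> nat \<Rightarrow> real" where
  "jacobi_coeff \<nu> n k = ((real n + \<nu>) gchoose (n - k)) * ((real n + \<nu>) gchoose k)"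

text \<open>The ultraspherical Jacobi polynomial as a polynomial object, so that
  \<open>pderiv\<close> applies; \<open>\<nu>\<close> is the Jacobi parameter, which is the usual
  Gegenbauer index minus 1/2.\<close>

definition gegenbauer :: "real \<Rightarrow> nat \<Rightarrow> real poly" where
  "gegenbauer \<nu> n =
     (\<Sum>k\<le>n. smult (jacobi_coeff \<nu> n k) ([:-1/2, 1/2:] ^ k * [:1/2, 1/2:] ^ (n - k)))"

lemma poly_gegenbauer: "poly (gegenbauer \<nu> n) x = jacobi_poly \<nu> \<nu> n x"
proof -
  have "poly [:-1/2, 1/2:] x = (x - 1) / 2" "poly [:1/2, 1/2:] x = (x + 1) / 2"
    by (simp_all add: field_simps)
  then show ?thesis
    unfolding gegenbauer_def jacobi_poly_def jacobi_coeff_def poly_sum poly_smult poly_mult poly_power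
    by (simp only: mult.assoc)
qed

text \<open>The absorption identity for generalized binomials, used once for each of the two
  factors. It is exactly the relation between neighbouring coefficients that the off-diagonal terms
  of the differential operator require.\<close>

lemma jacobi_coeff_Suc:
  assumes "k < n"
  shows "jacobi_coeff \<nu> n (Suc k) * (real (Suc k) * (real (Suc k) + \<nu>)) =
    jacobi_coeff \<nu> n k * (real (n - k) * (real (n - k) + \<nu>))"
proof -
  let ?z = "real n + \<nu>"
  obtain j where j: "n - k = Suc j" using assms by (metis Suc_diff_Suc)
  then have j': "n - Suc k = j" "real n = real k + real j + 1" using assms by linarith+
  have 1: "(?z gchoose Suc k) * real (Suc k) = (?z - real k) * (?z gchoose k)"
    using gbinomial_mult_1[of ?z k] by (simp add: algebra_simps)
  have 2: "(?z gchoose Suc j) * real (Suc j) = (?z - real j) * (?z gchoose j)"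
    using gbinomial_mult_1[of ?z j] by (simp add: algebra_simps)
  have "jacobi_coeff \<nu> n (Suc k) * (real (Suc k) * (real (Suc k) + \<nu>))
     = ((?z gchoose Suc k) * real (Suc k)) * ((?z - real j) * (?z gchoose j))"
    by (simp add: jacobi_coeff_def j' algebra_simps)
  also have "\<dots> = ((?z - real k) * (?z gchoose k)) * ((?z gchoose Suc j) * real (Suc j))"
    unfolding 1 2 ..
  also have "\<dots> = jacobi_coeff \<nu> n k * (real (n - k) * (real (n - k) + \<nu>))"
    by (simp add: jacobi_coeff_def j j'(2) algebra_simps)
  finally show ?thesis .
qed

text \<open>The operator (1 - x^2) q'' - 2 (\<nu> + 1) x q'. For \<nu> = (d - 2)/2 the constant 2
  (\<nu> + 1) is d, and this is the spherical Laplacian on zonal functions in the variable x = cos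
  \<theta>.\<close>

definition gegenbauer_operator :: "real \<Rightarrow> real poly \<Rightarrow> real poly" where
  "gegenbauer_operator \<nu> q =
     [:1, 0, -1:] * pderiv (pderiv q) - smult (2 * (\<nu> + 1)) ([:0, 1:] * pderiv q)"

lemma gegenbauer_operator_smult: "gegenbauer_operator \<nu> (smult c q) = smult c (gegenbauer_operator \<nu> q)"
  by (simp only: gegenbauer_operator_def pderiv_smult mult_smult_left mult_smult_right smult_diff_right smult_smult mult.commute)

lemma gegenbauer_operator_add:
  "gegenbauer_operator \<nu> (q + r) = gegenbauer_operator \<nu> q + gegenbauer_operator \<nu> r"
  by (simp add: gegenbauer_operator_def pderiv_add smult_add_right distrib_left)

lemma gegenbauer_operator_sum: "gegenbauer_operator \<nu> (\<Sum>i\<in>I. q i) = (\<Sum>i\<in>I. gegenbauer_operator \<nu> (q i))"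
proof (induction I rule: infinite_finite_induct)
  case (insert i I)
  then show ?case by (simp add: gegenbauer_operator_add)
qed (simp_all add: gegenbauer_operator_def)

text \<open>
  In the variables \<open>a = (x - 1) / 2\<close> and \<open>b = (x + 1) / 2\<close>, with \<open>b - a = 1\<close>, the operator
  preserves homogeneous polynomials of degree \<open>n\<close> and is tridiagonal on monomials.
\<close>

lemma poly_gegenbauer_operator_monomial:
  fixes x \<nu> :: real
  assumes "k \<le> n"
  defines "a \<equiv> (x - 1) / 2" and "b \<equiv> (x + 1) / 2"
  shows "poly (gegenbauer_operator \<nu> ([:-1/2, 1/2:] ^ k * [:1/2, 1/2:] ^ (n - k))) x =
    (2 * real k * real k - 2 * real n * real k - (\<nu> + 1) * real n) * (a ^ k * b ^ (n - k))
    - real k * (real k + \<nu>) * (a ^ (k - 1) * b ^ (Suc n - k))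
    - real (n - k) * (real (n - k) + \<nu>) * (a ^ Suc k * b ^ (n - Suc k))"
proof -
  define j where "j = n - k"
  have n: "n = k + j" using assms by (simp add: j_def)
  let ?A = "[:-1/2, 1/2:] :: real poly" and ?B = "[:1/2, 1/2:] :: real poly"
  have A: "pderiv (?A ^ i) = smult (real i / 2) (?A ^ (i - 1))" for i
    by (cases i) (simp_all add: pderiv_power_Suc pderiv_pCons del: power_Suc mult_pCons_left of_nat_Suc)
  have B: "pderiv (?B ^ i) = smult (real i / 2) (?B ^ (i - 1))" for i
    by (cases i) (simp_all add: pderiv_power_Suc pderiv_pCons del: power_Suc mult_pCons_left of_nat_Suc)
  have ab: "poly ?A x = a" "poly ?B x = b" "x = a + b" "1 - x * x = - 4 * a * b"
    by (simp_all add: a_def b_def field_simps)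
  have x2: "poly [:1, 0, -1:] x = - 4 * a * b" "poly [:0, 1:] x = a + b"
    unfolding ab(4)[symmetric] ab(3)[symmetric] by simp_all
  have 1: "poly (pderiv (?A ^ k * ?B ^ j)) x =
     (real k * a ^ (k - 1) * b ^ j + real j * a ^ k * b ^ (j - 1)) / 2"
    unfolding pderiv_mult A B poly_add poly_mult poly_smult poly_power ab(1,2) by (simp add: field_simps)
  have 2: "poly (pderiv (pderiv (?A ^ k * ?B ^ j))) x =
     (real k * real (k - 1) * a ^ (k - 1 - 1) * b ^ j + 2 * real k * real j * a ^ (k - 1) * b ^ (j - 1)
      + real j * real (j - 1) * a ^ k * b ^ (j - 1 - 1)) / 4"
    unfolding pderiv_mult pderiv_add pderiv_smult A B poly_add poly_mult poly_smult poly_power ab(1,2)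
    by (simp add: field_simps)
  \<comment> \<open>These four identities restore a power lost in differentiation. They also hold
    for k or j in {0, 1}, where natural subtraction truncates, because the numerical factors
    vanish.\<close>
  have k2: "real k * real (k - 1) * a ^ (k - 1 - 1) * a = real k * (real k - 1) * a ^ (k - 1)"
    by (cases k; cases "k - 1") auto
  have k1: "real k * a ^ (k - 1) * a = real k * a ^ k" by (cases k) auto
  have j2: "real j * real (j - 1) * b ^ (j - 1 - 1) * b = real j * (real j - 1) * b ^ (j - 1)"
    by (cases j; cases "j - 1") auto
  have j1: "real j * b ^ (j - 1) * b = real j * b ^ j" by (cases j) auto
  have "poly (gegenbauer_operator \<nu> (?A ^ k * ?B ^ j)) x =
     - ((real k * real (k - 1) * a ^ (k - 1 - 1) * a) * b ^ j * b
        + 2 * (real k * a ^ (k - 1) * a) * (real j * b ^ (j - 1) * b)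
        + (real j * real (j - 1) * b ^ (j - 1 - 1) * b) * a ^ k * a)
     - (\<nu> + 1) * ((real k * a ^ (k - 1) * a) * b ^ j + real k * a ^ (k - 1) * b ^ j * b
        + real j * b ^ (j - 1) * a ^ k * a + (real j * b ^ (j - 1) * b) * a ^ k)"
    unfolding gegenbauer_operator_def poly_diff poly_mult poly_smult 1 2 x2
    by (simp add: field_simps)
  also have "\<dots> = (2 * real k * real k - 2 * real n * real k - (\<nu> + 1) * real n) * (a ^ k * b ^ j)
    - real k * (real k + \<nu>) * (a ^ (k - 1) * b ^ Suc j)
    - real j * (real j + \<nu>) * (a ^ Suc k * b ^ (j - 1))"
    unfolding k2 k1 j2 j1 n by (simp add: algebra_simps)
  finally show ?thesis using n by (simp add: Suc_diff_le)
qed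


text \<open>After an index shift the coefficient recursion turns both off-diagonal sums into
  multiples of the diagonal monomials; the boundary terms k = 0 and k = n drop out through the
  factors k and n - k. What remains is 2k^2 - 2nk - (\<nu> + 1) n - (n - k)(n - k + \<nu>) - k (k +
  \<nu>) = -n (n + 2 \<nu> + 1), independent of k.\<close>

lemma gegenbauer_eigenfunction:
  "gegenbauer_operator \<nu> (gegenbauer \<nu> n) =
     smult (- (real n * (real n + 2 * \<nu> + 1))) (gegenbauer \<nu> n)"
proof -
  have "poly (gegenbauer_operator \<nu> (gegenbauer \<nu> n)) x =
     poly (smult (- (real n * (real n + 2 * \<nu> + 1))) (gegenbauer \<nu> n)) x" for x
  proof -
    define a where "a = (x - 1) / 2"
    define b where "b = (x + 1) / 2"
    let ?c = "jacobi_coeff \<nu> n"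
    let ?T = "\<lambda>k. a ^ k * b ^ (n - k)"
    have "poly (gegenbauer_operator \<nu> (gegenbauer \<nu> n)) x =
      (\<Sum>k\<le>n. ?c k * ((2 * real k * real k - 2 * real n * real k - (\<nu> + 1) * real n) * ?T k
        - real k * (real k + \<nu>) * (a ^ (k - 1) * b ^ (Suc n - k))
        - real (n - k) * (real (n - k) + \<nu>) * (a ^ Suc k * b ^ (n - Suc k))))"
      unfolding gegenbauer_def gegenbauer_operator_sum gegenbauer_operator_smult poly_sum poly_smult a_def b_def
      by (intro sum.cong refl) (subst poly_gegenbauer_operator_monomial; simp)
    also have "\<dots> = (\<Sum>k\<le>n. ?c k * (2 * real k * real k - 2 * real n * real k - (\<nu> + 1) * real n) * ?T k)
        - (\<Sum>k\<le>n. ?c k * (real k * (real k + \<nu>)) * (a ^ (k - 1) * b ^ (Suc n - k)))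
        - (\<Sum>k\<le>n. ?c k * (real (n - k) * (real (n - k) + \<nu>)) * (a ^ Suc k * b ^ (n - Suc k)))"
      by (simp add: sum_subtractf[symmetric] algebra_simps)
    also have "(\<Sum>k\<le>n. ?c k * (real k * (real k + \<nu>)) * (a ^ (k - 1) * b ^ (Suc n - k)))
        = (\<Sum>k<n. ?c (Suc k) * (real (Suc k) * (real (Suc k) + \<nu>)) * ?T k)"
      by (subst sum.atMost_shift) simp
    also have "\<dots> = (\<Sum>k<n. ?c k * (real (n - k) * (real (n - k) + \<nu>)) * ?T k)"
      by (intro sum.cong refl) (subst jacobi_coeff_Suc, auto)
    also have "\<dots> = (\<Sum>k\<le>n. ?c k * (real (n - k) * (real (n - k) + \<nu>)) * ?T k)"
      by (simp add: lessThan_Suc_atMost[symmetric])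
    also have "(\<Sum>k\<le>n. ?c k * (real (n - k) * (real (n - k) + \<nu>)) * (a ^ Suc k * b ^ (n - Suc k)))
        = (\<Sum>k<n. ?c k * (real (n - k) * (real (n - k) + \<nu>)) * (a ^ Suc k * b ^ (n - Suc k)))"
      by (simp add: lessThan_Suc_atMost[symmetric])
    also have "\<dots> = (\<Sum>k<n. ?c (Suc k) * (real (Suc k) * (real (Suc k) + \<nu>)) * ?T (Suc k))"
      by (intro sum.cong refl) (subst jacobi_coeff_Suc, auto)
    also have "\<dots> = (\<Sum>k\<le>n. ?c k * (real k * (real k + \<nu>)) * ?T k)"
      by (subst sum.atMost_shift) simp
    also have "(\<Sum>k\<le>n. ?c k * (2 * real k * real k - 2 * real n * real k - (\<nu> + 1) * real n) * ?T k)
        - (\<Sum>k\<le>n. ?c k * (real (n - k) * (real (n - k) + \<nu>)) * ?T k)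
        - (\<Sum>k\<le>n. ?c k * (real k * (real k + \<nu>)) * ?T k)
        = (\<Sum>k\<le>n. (- (real n * (real n + 2 * \<nu> + 1))) * (?c k * ?T k))"
      unfolding sum_subtractf[symmetric]
      by (intro sum.cong refl) (simp add: of_nat_diff algebra_simps)
    also have "\<dots> = poly (smult (- (real n * (real n + 2 * \<nu> + 1))) (gegenbauer \<nu> n)) x"
      unfolding poly_smult poly_gegenbauer sum_distrib_left[symmetric]
      by (simp add: jacobi_poly_def jacobi_coeff_def a_def b_def mult.assoc)
    finally show ?thesis .
  qed
  then show ?thesis by (intro poly_ext)
qed

section \<open>Integrals of zonal polynomials\<close>

definition zonal_integral :: "nat \<Rightarrow> real poly \<Rightarrow> real" where
  "zonal_integral d q = integral {0..pi} (\<lambda>\<theta>. poly q (cos \<theta>) * sin \<theta> ^ (d - 1))"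

lemma continuous_on_zonal_integrand:
  "continuous_on S (\<lambda>\<theta>. poly q (cos \<theta>) * sin \<theta> ^ n)" for q :: "real poly"
  by (intro continuous_intros continuous_on_poly)

lemma zonal_integrable [simp]:
  "(\<lambda>\<theta>. poly q (cos \<theta>) * sin \<theta> ^ n) integrable_on {a..b :: real}"
  by (intro integrable_continuous_real continuous_on_zonal_integrand)

lemma zonal_integral_add: "zonal_integral d (q + r) = zonal_integral d q + zonal_integral d r"
  unfolding zonal_integral_def poly_add distrib_right
  by (rule Henstock_Kurzweil_Integration.integral_add) simp_all

lemma zonal_integral_smult: "zonal_integral d (smult c q) = c * zonal_integral d q"
  unfolding zonal_integral_def poly_smult mult.assoc by simp

lemma zonal_integral_0 [simp]: "zonal_integral d 0 = 0"
  by (simp add: zonal_integral_def)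

lemma zonal_integral_sum: "zonal_integral d (\<Sum>i\<in>I. q i) = (\<Sum>i\<in>I. zonal_integral d (q i))"
  by (induction I rule: infinite_finite_induct) (simp_all add: zonal_integral_add)

lemma zonal_integral_nonneg:
  assumes "\<And>t. \<bar>t\<bar> \<le> 1 \<Longrightarrow> 0 \<le> poly q t"
  shows "0 \<le> zonal_integral d q"
  unfolding zonal_integral_def
  by (rule integral_nonneg) (use assms in \<open>auto simp: sin_ge_zero abs_le_iff intro!: mult_nonneg_nonneg zero_le_power\<close>)

lemma zonal_integral_1_pos: "0 < zonal_integral d 1"
proof -
  have "zonal_integral d 1 \<noteq> 0"
  proof
    assume "zonal_integral d 1 = 0"
    then have "((\<lambda>\<theta>. poly 1 (cos \<theta>) * sin \<theta> ^ (d - 1)) has_integral 0) (cbox 0 pi)"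
      unfolding zonal_integral_def by (metis cbox_interval has_integral_integral zonal_integrable)
    then have "poly 1 (cos (pi / 2)) * sin (pi / 2) ^ (d - 1) = (0 :: real)"
      by (rule has_integral_0_cbox_imp_0[rotated 2])
        (use pi_gt_zero in \<open>auto intro!: continuous_intros simp: sin_ge_zero simp del: pi_gt_zero\<close>)
    then show False by simp
  qed
  moreover have "0 \<le> zonal_integral d 1" by (rule zonal_integral_nonneg) simp
  ultimately show ?thesis by simp
qed

text \<open>The boundary terms carry the factor \<open>sin\<^sup>d\<close>, which vanishes at both poles.\<close>

lemma zonal_integral_by_parts:
  assumes "d \<ge> 1"
  shows "zonal_integral d ([:1, 0, -1:] * pderiv \<phi> * pderiv \<psi>) =
    - zonal_integral d (\<phi> * gegenbauer_operator ((real d - 2) / 2) \<psi>)"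
proof -
  let ?op = "gegenbauer_operator ((real d - 2) / 2) \<psi>"
  let ?F = "\<lambda>\<theta>. poly \<phi> (cos \<theta>) * poly (pderiv \<psi>) (cos \<theta>) * sin \<theta> ^ d"
  let ?r = "- ([:1, 0, -1:] * pderiv \<phi> * pderiv \<psi> + \<phi> * ?op)"
  obtain n where n: "d = Suc n" using assms by (cases d) auto
  have s: "1 - cos \<theta> * cos \<theta> = sin \<theta> * sin \<theta>" for \<theta> :: real
    using sin_cos_squared_add[of \<theta>] by (simp add: power2_eq_square)
  have "(?F has_real_derivative poly ?r (cos \<theta>) * sin \<theta> ^ (d - 1)) (at \<theta>)" for \<theta>
  proof -
    have w: "poly [:1, 0, -1:] (cos \<theta>) = sin \<theta> * sin \<theta>"
      using s[of \<theta>] by (simp add: algebra_simps)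
    have c: "((\<lambda>\<theta>. poly q (cos \<theta>)) has_real_derivative poly (pderiv q) (cos \<theta>) * - sin \<theta>) (at \<theta>)" for q :: "real poly"
      by (rule DERIV_chain2[OF poly_DERIV DERIV_cos])
    have d: "2 * ((real d - 2) / 2 + 1) = real d" by (simp add: field_simps)
    have x: "poly [:0, 1:] (cos \<theta>) = cos \<theta>" by simp
    show ?thesis
      unfolding gegenbauer_operator_def d poly_minus poly_add poly_diff poly_mult poly_smult w x
      by (intro DERIV_cong[OF DERIV_mult[OF DERIV_mult[OF c c] DERIV_power[OF DERIV_sin]]])
        (simp add: n algebra_simps)
  qed
  then have "((\<lambda>\<theta>. poly ?r (cos \<theta>) * sin \<theta> ^ (d - 1)) has_integral (?F pi - ?F 0)) {0..pi}"
    by (intro fundamental_theorem_of_calculus)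
      (auto simp: has_real_derivative_iff_has_vector_derivative[symmetric] intro: has_field_derivative_at_within)
  then have "zonal_integral d ?r = 0"
    using assms unfolding zonal_integral_def by (simp add: integral_unique)
  moreover have "zonal_integral d ?r = - (zonal_integral d ([:1, 0, -1:] * pderiv \<phi> * pderiv \<psi>) + zonal_integral d (\<phi> * ?op))"
    using zonal_integral_smult[of d "-1" "[:1, 0, -1:] * pderiv \<phi> * pderiv \<psi> + \<phi> * ?op"]
    by (simp only: zonal_integral_add) (simp add: zonal_integral_add)
  ultimately show ?thesis by linarith
qed

text \<open>Integration by parts against the coordinate x itself, which is an eigenfunction with
  eigenvalue -d. For DIM = d + 1 the recursion agrees with the one for the surface measure.\<close>

lemma zonal_moment_recursion:
  assumes "d \<ge> 1"
  shows "(real d + real k) * zonal_integral d (monom 1 (Suc k)) = real k * zonal_integral d (monom 1 (k - 1))"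
proof -
  have "pderiv [:0, 1:] = (1 :: real poly)" by (simp add: pderiv_pCons)
  moreover have "2 * ((real d - 2) / 2 + 1) = real d" by (simp add: field_simps)
  ultimately have op: "gegenbauer_operator ((real d - 2) / 2) [:0, 1:] = smult (- real d) [:0, 1:]"
    unfolding gegenbauer_operator_def by simp
  have 1: "[:1, 0, -1:] * pderiv (monom 1 k) * pderiv [:0, 1:] =
     smult (real k) (monom 1 (k - 1)) + smult (- real k) (monom 1 (Suc k))"
    by (rule poly_ext) (cases k; simp add: pderiv_monom poly_monom pderiv_pCons algebra_simps)
  have 2: "monom 1 k * smult (- real d) [:0, 1:] = smult (- real d) (monom 1 (Suc k))"
    by (rule poly_ext) (simp add: poly_monom algebra_simps)
  show ?thesis
    using zonal_integral_by_parts[OF assms, of "monom 1 k" "[:0, 1:]"]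
    unfolding op 1 2 zonal_integral_add zonal_integral_smult by (simp add: algebra_simps)
qed

text \<open>At k = 0 the common recursion kills the first moment, and then it steps by two; so each
  moment sequence is determined by its zeroth term. The two functionals are proportional on
  monomials, hence on polynomials.\<close>

lemma integral_surface_measure_poly:
  fixes e :: "'a::euclidean_space"
  assumes "DIM('a) = d + 1" "d \<ge> 1" "norm e = 1"
  shows "(\<integral>x. poly q (x \<bullet> e) \<partial>surface_measure) =
    sphere_area TYPE('a) / zonal_integral d 1 * zonal_integral d q"
proof -
  let ?M = "\<lambda>k. \<integral>x. (x \<bullet> e) ^ k \<partial>surface_measure" and ?N = "\<lambda>k. zonal_integral d (monom 1 k)"
  interpret finite_measure "surface_measure :: 'a measure" by (rule finite_measure_surface_measure)
  have M: "(real d + real k) * ?M (Suc k) = real k * ?M (k - 1)" for k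
    using surface_moment_recursion[OF assms(3), of k] assms(1) by simp
  have N: "(real d + real k) * ?N (Suc k) = real k * ?N (k - 1)" for k
    by (rule zonal_moment_recursion) fact
  \<comment> \<open>Cross-multiplied, so that the total mass of the sphere need not be known to be
    nonzero here.\<close>
  have eq: "?M k * ?N 0 = ?N k * ?M 0" for k
  proof (induction k rule: less_induct)
    case (less k)
    show ?case
    proof (cases k)
      case (Suc i)
      have "(real d + real i) * (?M k * ?N 0) = real i * (?M (i - 1) * ?N 0)"
        using M[of i] Suc by (simp add: mult.assoc[symmetric])
      also have "\<dots> = real i * (?N (i - 1) * ?M 0)"
        using less.IH[of "i - 1"] Suc by simp
      also have "\<dots> = (real d + real i) * (?N k * ?M 0)"
        using N[of i] Suc by (simp add: mult.assoc[symmetric])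
      finally show ?thesis using assms(2) by simp
    qed simp
  qed
  have M0: "?M 0 = sphere_area TYPE('a)" by (simp add: sphere_area_def)
  have N0: "?N 0 = zonal_integral d 1" by (simp add: monom_0 one_pCons)
  have int: "integrable surface_measure (\<lambda>x. (x \<bullet> e) ^ k)" for k
  proof (rule integrable_const_bound[where B = 1])
    have "\<bar>(x \<bullet> e) ^ k\<bar> \<le> 1" if "norm x = 1" for x
      using that Cauchy_Schwarz_ineq2[of x e] assms(3) by (simp add: power_abs power_le_one)
    then show "AE x in surface_measure. norm ((x \<bullet> e) ^ k) \<le> 1"
      by (intro AE_I2) simp
  qed (intro borel_measurable_surface_measure, measurable)
  have "(\<integral>x. poly q (x \<bullet> e) \<partial>surface_measure) = (\<Sum>k\<le>degree q. coeff q k * ?M k)"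
    unfolding poly_altdef using int by (simp add: Bochner_Integration.integral_sum)
  also have "\<dots> = (\<Sum>k\<le>degree q. coeff q k * (sphere_area TYPE('a) / zonal_integral d 1 * ?N k))"
    using eq zonal_integral_1_pos[of d] unfolding M0 N0 by (intro sum.cong refl) (simp add: field_simps)
  also have "\<dots> = sphere_area TYPE('a) / zonal_integral d 1 * zonal_integral d (\<Sum>k\<le>degree q. smult (coeff q k) (monom 1 k))"
    by (simp add: zonal_integral_sum zonal_integral_smult sum_distrib_left algebra_simps)
  also have "(\<Sum>k\<le>degree q. smult (coeff q k) (monom 1 k)) = q"
    by (simp add: smult_monom poly_as_sum_of_monoms)
  finally show ?thesis .
qed

lemma zonal_integral_gegenbauer_deriv:
  assumes "d \<ge> 1"
  defines "G \<equiv> gegenbauer ((real d - 2) / 2)"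
  shows "zonal_integral d ([:1, 0, -1:] * pderiv (G m) * pderiv (G n)) =
    real n * (real n + real d - 1) * zonal_integral d (G m * G n)"
proof -
  have "real n + 2 * ((real d - 2) / 2) + 1 = real n + real d - 1" by (simp add: field_simps)
  then show ?thesis
    unfolding zonal_integral_by_parts[OF assms(1)] G_def gegenbauer_eigenfunction mult_smult_right
      zonal_integral_smult by simp
qed

text \<open>The Dirichlet form is symmetric, and it equals the inner product times either of the two
  eigenvalues. Their difference (n - m)(n + m + d - 1) is nonzero.\<close>

lemma zonal_integral_gegenbauer_orthogonal:
  assumes "d \<ge> 1" "m \<noteq> n"
  defines "G \<equiv> gegenbauer ((real d - 2) / 2)"
  shows "zonal_integral d (G m * G n) = 0"
proof -
  have eqs: "[:1, 0, -1:] * pderiv (G m) * pderiv (G n) = [:1, 0, -1:] * pderiv (G n) * pderiv (G m)"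
    "G n * G m = G m * G n"
    by (simp_all only: mult.assoc mult.commute[of "pderiv (G m)"] mult.commute[of "G n"])
  have "real n * (real n + real d - 1) * zonal_integral d (G m * G n) =
     real m * (real m + real d - 1) * zonal_integral d (G m * G n)"
    using zonal_integral_gegenbauer_deriv[OF assms(1), of m n, folded G_def]
      zonal_integral_gegenbauer_deriv[OF assms(1), of n m, folded G_def]
    unfolding eqs by linarith
  then have "(real n - real m) * (real n + real m + (real d - 1)) * zonal_integral d (G m * G n) = 0"
    by (simp add: algebra_simps)
  moreover have "real n + real m + (real d - 1) > 0" using assms(1,2) by (cases m; cases n) auto
  ultimately show ?thesis using assms(2) by simp
qed

lemma pderiv_sum: "pderiv (\<Sum>i\<in>I. q i) = (\<Sum>i\<in>I. pderiv (q i))"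
  by (induction I rule: infinite_finite_induct) (simp_all add: pderiv_add)

definition zonal_poly :: "nat \<Rightarrow> nat \<Rightarrow> real poly" where
  "zonal_poly d n = (let G = gegenbauer ((real d - 2) / 2) n in
     smult (1 / sqrt (zonal_integral d (G * G) / zonal_integral d 1)) G)"

text \<open>In the normalizing factor the area of the sphere cancels, which leaves a constant
  computed from one-dimensional integrals.\<close>

lemma zonal_harmonic_eq_poly:
  fixes e :: "'a::euclidean_space"
  assumes "DIM('a) = d + 1" "d \<ge> 1" "norm e = 1" "sphere_area TYPE('a) \<noteq> 0"
  shows "zonal_harmonic e n x = poly (zonal_poly d n) (x \<bullet> e)"
proof -
  let ?G = "gegenbauer ((real d - 2) / 2) n"
  have z: "zonal_jacobi e n y = poly ?G (y \<bullet> e)" for y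
    using assms(1) by (simp add: zonal_jacobi_def poly_gegenbauer)
  have "(\<integral>y. (zonal_jacobi e n y)\<^sup>2 \<partial>surface_measure) =
      sphere_area TYPE('a) / zonal_integral d 1 * zonal_integral d (?G * ?G)"
    using integral_surface_measure_poly[OF assms(1-3), of "?G * ?G"] by (simp add: z power2_eq_square)
  then show ?thesis
    using assms(4) by (simp add: zonal_harmonic_def zonal_poly_def Let_def z)
qed

text \<open>(1 - x^2) (S')^2 at x = cos \<theta> is the squared \<theta>-derivative, so the left
  side is the Dirichlet energy of the partial sum. Orthogonality removes the mixed terms, and each
  diagonal term carries the eigenvalue n (n + d - 1).\<close>

lemma zonal_integral_energy:
  fixes b :: "nat \<Rightarrow> real"
  assumes "d \<ge> 1"
  defines "S \<equiv> \<lambda>N. \<Sum>n\<le>N. smult (b n) (zonal_poly d n)"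
  shows "zonal_integral d ([:1, 0, -1:] * pderiv (S N) * pderiv (S N)) \<le>
    zonal_integral d 1 * (\<Sum>n\<le>N. real d * (real n)\<^sup>2 * (b n)\<^sup>2)"
proof -
  let ?G = "gegenbauer ((real d - 2) / 2)" and ?I = "zonal_integral d"
  define r where "r n = 1 / sqrt (?I (?G n * ?G n) / ?I 1)" for n
  have Y: "zonal_poly d n = smult (r n) (?G n)" for n by (simp add: zonal_poly_def r_def Let_def)
  have GG: "0 \<le> ?I (?G n * ?G n)" for n by (rule zonal_integral_nonneg) simp
  \<comment> \<open>Really an equality when the norm of \<open>?G n\<close> is positive. Stated as
    an inequality it also covers norm 0, where division by zero makes \<open>r n\<close> equal to
    0.\<close>
  have r: "(r n)\<^sup>2 * ?I (?G n * ?G n) \<le> ?I 1" for n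
    using GG[of n] zonal_integral_1_pos[of d] by (simp add: r_def power_divide)
  have D: "?I ([:1, 0, -1:] * pderiv (?G m) * pderiv (?G n)) =
      (if m = n then real n * (real n + real d - 1) * ?I (?G n * ?G n) else 0)" for m n
    using zonal_integral_gegenbauer_deriv[OF assms(1), of m n] zonal_integral_gegenbauer_orthogonal[OF assms(1), of m n]
    by simp
  have pS: "pderiv (S N) = (\<Sum>n\<le>N. smult (b n * r n) (pderiv (?G n)))"
    by (simp add: S_def Y pderiv_sum pderiv_smult)
  have "?I ([:1, 0, -1:] * pderiv (S N) * pderiv (S N)) =
     ?I (\<Sum>m\<le>N. \<Sum>n\<le>N. smult (b m * r m * (b n * r n)) ([:1, 0, -1:] * pderiv (?G m) * pderiv (?G n)))"
    unfolding pS sum_distrib_left[of "[:1, 0, -1:]"] sum_product mult_smult_left mult_smult_right smult_smult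
    by (simp only: mult.commute)
  also have "\<dots> = (\<Sum>m\<le>N. \<Sum>n\<le>N. b m * r m * (b n * r n) * (if m = n then real n * (real n + real d - 1) * ?I (?G n * ?G n) else 0))"
    unfolding zonal_integral_sum zonal_integral_smult D ..
  also have "\<dots> = (\<Sum>m\<le>N. b m * r m * (b m * r m) * (real m * (real m + real d - 1) * ?I (?G m * ?G m)))"
    by (intro sum.cong refl) (simp add: if_distrib[of "(*) _"] cong: if_cong)
  also have "\<dots> \<le> (\<Sum>n\<le>N. (b n)\<^sup>2 * (real d * (real n)\<^sup>2) * ?I 1)"
  proof (rule sum_mono)
    fix n
    \<comment> \<open>The difference of the two sides is (d - 1) n (n - 1).\<close>
    have "real n * (real n + real d - 1) \<le> real d * (real n)\<^sup>2"
    proof (cases n)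
      case (Suc i)
      have "0 \<le> real n * ((real d - 1) * (real n - 1))"
        using assms(1) Suc by (intro mult_nonneg_nonneg) auto
      then show ?thesis by (simp add: algebra_simps power2_eq_square)
    qed simp
    then have "(b n)\<^sup>2 * (real n * (real n + real d - 1)) * ((r n)\<^sup>2 * ?I (?G n * ?G n)) \<le>
        (b n)\<^sup>2 * (real d * (real n)\<^sup>2) * ?I 1"
      by (rule mult_mono[OF mult_left_mono[OF _ zero_le_power2] r]) (use GG[of n] assms(1) in auto)
    then show "b n * r n * (b n * r n) * (real n * (real n + real d - 1) * ?I (?G n * ?G n)) \<le>
        (b n)\<^sup>2 * (real d * (real n)\<^sup>2) * ?I 1"
      by (simp only: power2_eq_square mult.assoc mult.left_commute mult.commute)
  qed
  also have "\<dots> = ?I 1 * (\<Sum>n\<le>N. real d * (real n)\<^sup>2 * (b n)\<^sup>2)"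
    by (simp add: sum_distrib_left algebra_simps)
  finally show ?thesis .
qed

section \<open>Oscillation of zonal functions\<close>

text \<open>A pointwise 2 t \<le> 1 + t^2 with t = |q'(cos \<theta>)| sin \<theta>, the size of the
  \<theta>-derivative. It takes the place of Cauchy-Schwarz, since any bound uniform along the
  partial sums will do.\<close>

lemma integral_abs_deriv_le_energy:
  assumes "d \<ge> 1"
  shows "integral {0..pi} (\<lambda>\<theta>. \<bar>poly (pderiv q) (cos \<theta>)\<bar> * sin \<theta> ^ d) \<le>
    (zonal_integral d 1 + zonal_integral d ([:1, 0, -1:] * pderiv q * pderiv q)) / 2"
proof -
  let ?y = "\<lambda>\<theta>. poly (pderiv q) (cos \<theta>)"
  have "integral {0..pi} (\<lambda>\<theta>. \<bar>?y \<theta>\<bar> * sin \<theta> ^ d) \<le>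
    integral {0..pi} (\<lambda>\<theta>. poly (smult (1/2) (1 + [:1, 0, -1:] * pderiv q * pderiv q)) (cos \<theta>) * sin \<theta> ^ (d - 1))"
  proof (rule integral_le)
    show "(\<lambda>\<theta>. \<bar>?y \<theta>\<bar> * sin \<theta> ^ d) integrable_on {0..pi}"
      by (intro integrable_continuous_real continuous_intros continuous_on_poly)
    fix \<theta> :: real assume \<theta>: "\<theta> \<in> {0..pi}"
    then have s: "sin \<theta> \<ge> 0" by (simp add: sin_ge_zero)
    have w: "poly [:1, 0, -1:] (cos \<theta>) = sin \<theta> ^ 2"
      using sin_squared_eq[of \<theta>] by (simp add: power2_eq_square)
    have "0 \<le> (\<bar>?y \<theta>\<bar> * sin \<theta> - 1)\<^sup>2" by simp
    then have "\<bar>?y \<theta>\<bar> * sin \<theta> \<le> (1 + (sin \<theta>)\<^sup>2 * ?y \<theta> * ?y \<theta>) / 2"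
      by (simp add: power2_diff power_mult_distrib) (simp add: power2_eq_square algebra_simps)
    then have "\<bar>?y \<theta>\<bar> * sin \<theta> * sin \<theta> ^ (d - 1) \<le> (1 + (sin \<theta>)\<^sup>2 * ?y \<theta> * ?y \<theta>) / 2 * sin \<theta> ^ (d - 1)"
      using s by (intro mult_right_mono) auto
    moreover have "sin \<theta> ^ d = sin \<theta> * sin \<theta> ^ (d - 1)" using assms by (cases d) auto
    ultimately show "\<bar>?y \<theta>\<bar> * sin \<theta> ^ d \<le>
        poly (smult (1/2) (1 + [:1, 0, -1:] * pderiv q * pderiv q)) (cos \<theta>) * sin \<theta> ^ (d - 1)"
      unfolding poly_smult poly_add poly_mult w by (simp add: mult.assoc)
  next
    show "(\<lambda>\<theta>. poly (smult (1/2) (1 + [:1, 0, -1:] * pderiv q * pderiv q)) (cos \<theta>) * sin \<theta> ^ (d - 1)) integrable_on {0..pi}"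
      by (rule zonal_integrable)
  qed
  also have "\<dots> = zonal_integral d (smult (1/2) (1 + [:1, 0, -1:] * pderiv q * pderiv q))"
    by (simp only: zonal_integral_def)
  also have "\<dots> = (zonal_integral d 1 + zonal_integral d ([:1, 0, -1:] * pderiv q * pderiv q)) / 2"
    by (simp only: zonal_integral_smult zonal_integral_add)
  finally show ?thesis .
qed

text \<open>The increment is at most the integral of |q'(cos \<theta>)| sin \<theta>. On an interval
  where sin \<theta> stays above \<sigma>, the prefactor \<sigma>^(d-1) may be pulled in and
  replaced by sin^(d-1) \<theta>.\<close>

lemma diff_poly_cos_le_integral:
  fixes q :: "real poly"
  assumes "d \<ge> 1" "0 \<le> u" "v \<le> pi" "\<alpha> \<in> {u..v}" "\<beta> \<in> {u..v}" "0 \<le> \<sigma>"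
    and \<sigma>: "\<And>\<theta>. \<theta> \<in> {u..v} \<Longrightarrow> \<sigma> \<le> sin \<theta>"
  shows "\<sigma> ^ (d - 1) * \<bar>poly q (cos \<alpha>) - poly q (cos \<beta>)\<bar> \<le>
    integral {u..v} (\<lambda>\<theta>. \<bar>poly (pderiv q) (cos \<theta>)\<bar> * sin \<theta> ^ d)"
  using assms(4,5)
proof (induction \<alpha> \<beta> rule: linorder_wlog)
  case (sym a b)
  then show ?case by (simp add: abs_minus_commute)
next
  case (le a b)
  let ?y = "\<lambda>\<theta>. poly (pderiv q) (cos \<theta>)"
  have sin: "0 \<le> sin \<theta>" if "\<theta> \<in> {u..v}" for \<theta>
    using that assms(2,3) by (intro sin_ge_zero) auto
  have "((\<lambda>\<theta>. poly q (cos \<theta>)) has_real_derivative ?y \<theta> * - sin \<theta>) (at \<theta>)" for \<theta>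
    by (rule DERIV_chain2[OF poly_DERIV DERIV_cos])
  then have "((\<lambda>\<theta>. ?y \<theta> * - sin \<theta>) has_integral (poly q (cos b) - poly q (cos a))) {a..b}"
    using le by (intro fundamental_theorem_of_calculus)
      (auto simp: has_real_derivative_iff_has_vector_derivative[symmetric] intro: has_field_derivative_at_within)
  then have "\<bar>poly q (cos a) - poly q (cos b)\<bar> = norm (integral {a..b} (\<lambda>\<theta>. ?y \<theta> * - sin \<theta>))"
    by (simp only: integral_unique real_norm_def abs_minus_commute)
  also have "\<dots> \<le> integral {a..b} (\<lambda>\<theta>. \<bar>?y \<theta>\<bar> * sin \<theta>)"
    using sin le by (intro integral_norm_bound_integral)
      (auto intro!: integrable_continuous_real continuous_intros continuous_on_poly simp: abs_mult)
  also have "\<dots> \<le> integral {u..v} (\<lambda>\<theta>. \<bar>?y \<theta>\<bar> * sin \<theta>)"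
    using sin le by (intro integral_subset_le)
      (auto intro!: integrable_continuous_real continuous_intros continuous_on_poly)
  finally have "\<sigma> ^ (d - 1) * \<bar>poly q (cos a) - poly q (cos b)\<bar> \<le>
      \<sigma> ^ (d - 1) * integral {u..v} (\<lambda>\<theta>. \<bar>?y \<theta>\<bar> * sin \<theta>)"
    using assms(6) by (intro mult_left_mono) auto
  also have "\<dots> = integral {u..v} (\<lambda>\<theta>. \<sigma> ^ (d - 1) * (\<bar>?y \<theta>\<bar> * sin \<theta>))"
    by simp
  also have "\<dots> \<le> integral {u..v} (\<lambda>\<theta>. \<bar>?y \<theta>\<bar> * sin \<theta> ^ d)"
  proof (rule integral_le)
    fix \<theta> assume \<theta>: "\<theta> \<in> {u..v}"
    have "\<sigma> ^ (d - 1) * (\<bar>?y \<theta>\<bar> * sin \<theta>) \<le> sin \<theta> ^ (d - 1) * (\<bar>?y \<theta>\<bar> * sin \<theta>)"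
      using sin[OF \<theta>] \<sigma>[OF \<theta>] assms(6) by (intro mult_right_mono power_mono) auto
    also have "\<dots> = \<bar>?y \<theta>\<bar> * sin \<theta> ^ d" using assms(1) by (cases d) auto
    finally show "\<sigma> ^ (d - 1) * (\<bar>?y \<theta>\<bar> * sin \<theta>) \<le> \<bar>?y \<theta>\<bar> * sin \<theta> ^ d" .
  qed (auto intro!: integrable_continuous_real continuous_intros continuous_on_poly)
  finally show ?case .
qed

text \<open>Up to \<pi>/3 the derivative of the sine is at least 1/2. Beyond, the sine is at least
  sqrt 3 / 2 \<ge> 2/3, while \<theta>/3 is at most \<pi>/6 < 2/3.\<close>

lemma sin_ge_third:
  fixes \<theta> :: real
  assumes "0 \<le> \<theta>" "\<theta> \<le> pi / 2"
  shows "\<theta> / 3 \<le> sin \<theta>"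
proof (cases "\<theta> \<le> pi / 3")
  case True
  have "sin 0 - 0 / 3 \<le> sin \<theta> - \<theta> / 3"
  proof (rule DERIV_nonneg_imp_nondecreasing[OF assms(1)])
    fix x :: real assume "0 \<le> x" "x \<le> \<theta>"
    then have "cos (pi / 3) \<le> cos x" using True by (intro cos_monotone_0_pi_le) auto
    then have "0 \<le> cos x - 1 / 3" by (simp add: cos_60)
    moreover have "((\<lambda>x. sin x - x / 3) has_real_derivative cos x - 1 / 3) (at x)"
      by (auto intro!: derivative_eq_intros)
    ultimately show "\<exists>y. ((\<lambda>x. sin x - x / 3) has_real_derivative y) (at x) \<and> 0 \<le> y" by blast
  qed
  then show ?thesis by simp
next
  case False
  then have "sin (pi / 3) \<le> sin \<theta>" using assms by (intro sin_monotone_2pi_le) auto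
  moreover have "4 / 3 \<le> sqrt 3" by (rule real_le_rsqrt) (simp add: power2_eq_square)
  ultimately show ?thesis using assms pi_less_4 by (simp add: sin_60)
qed

lemma sin_ge_min_third:
  fixes \<theta> :: real
  assumes "0 \<le> \<theta>" "\<theta> \<le> pi"
  shows "min \<theta> (pi - \<theta>) / 3 \<le> sin \<theta>"
  using sin_ge_third[of \<theta>] sin_ge_third[of "pi - \<theta>"] assms by (cases "\<theta> \<le> pi / 2") (auto simp: min_def)

text \<open>The points may stray into neighbouring zones, so each difference is charged to three
  consecutive cells; every cell is charged at most three times, whence 3 V. Leaving out two zones at
  each pole keeps the tripled zones at a distance from the poles comparable to \<kappa>
  \<eta>.\<close>

lemma sum_poly_cos_oscillation_le:
  fixes q :: "real poly" and \<alpha> \<beta> :: "nat \<Rightarrow> real"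
  assumes "d \<ge> 1" "m \<ge> 1"
    and V: "integral {0..pi} (\<lambda>\<theta>. \<bar>poly (pderiv q) (cos \<theta>)\<bar> * sin \<theta> ^ d) \<le> V"
    and near: "\<And>k. k \<in> {2..<m-2} \<Longrightarrow>
      \<alpha> k \<in> {(real k - 1) * (pi / m)..(real k + 2) * (pi / m)} \<and> \<beta> k \<in> {(real k - 1) * (pi / m)..(real k + 2) * (pi / m)}"
  shows "(\<Sum>k\<in>{2..<m-2}. real (min (k + 1) (m - k)) ^ (d - 1) * \<bar>poly q (cos (\<alpha> k)) - poly q (cos (\<beta> k))\<bar>)
     \<le> (5 * real m) ^ (d - 1) * (3 * V)"
proof -
  define \<eta> where "\<eta> = pi / real m"
  have \<eta>: "\<eta> > 0" "real m * \<eta> = pi" using assms(2) by (auto simp: \<eta>_def)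
  let ?K = "{2..<m-2}"
  define \<kappa> where "\<kappa> k = real (min (k + 1) (m - k))" for k
  define \<phi> where "\<phi> \<theta> = \<bar>poly (pderiv q) (cos \<theta>)\<bar> * sin \<theta> ^ d" for \<theta> :: real
  have int: "\<phi> integrable_on {a..b}" for a b
    unfolding \<phi>_def by (intro integrable_continuous_real continuous_intros continuous_on_poly)
  have \<phi>0: "0 \<le> \<phi> \<theta>" if "0 \<le> \<theta>" "\<theta> \<le> pi" for \<theta>
    using that by (simp add: \<phi>_def sin_ge_zero)
  define A where "A i = integral {real i * \<eta>..real (Suc i) * \<eta>} \<phi>" for i
  have A0: "0 \<le> A i" if "i < m" for i
    unfolding A_def
  proof (intro integral_nonneg int \<phi>0)
    fix x assume x: "x \<in> {real i * \<eta>..real (Suc i) * \<eta>}"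
    have "real (Suc i) * \<eta> \<le> real m * \<eta>" using that \<eta> by (intro mult_right_mono) auto
    then show "x \<le> pi" using x \<eta> by auto
    have "0 \<le> real i * \<eta>" using \<eta> by simp
    then show "0 \<le> x" using x by (meson atLeastAtMost_iff order_trans)
  qed
  have sumA: "(\<Sum>i<j. A i) = integral {0..real j * \<eta>} \<phi>" for j
  proof (induction j)
    case (Suc j)
    have "integral {0..real j * \<eta>} \<phi> + integral {real j * \<eta>..real (Suc j) * \<eta>} \<phi> = integral {0..real (Suc j) * \<eta>} \<phi>"
      using \<eta> by (intro Henstock_Kurzweil_Integration.integral_combine int) (auto simp: algebra_simps)
    then show ?case using Suc by (simp add: A_def)
  qed simp
  have tot: "(\<Sum>i<m. A i) \<le> V" using sumA[of m] V \<eta> by (simp add: \<phi>_def[abs_def])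
  have shift: "(\<Sum>k\<in>?K. A (f k)) \<le> V" if "inj_on f ?K" "f ` ?K \<subseteq> {..<m}" for f
  proof -
    have "(\<Sum>k\<in>?K. A (f k)) = sum A (f ` ?K)" by (simp add: sum.reindex[OF that(1)])
    also have "\<dots> \<le> sum A {..<m}" using that(2) A0 by (intro sum_mono2) auto
    finally show ?thesis using tot by simp
  qed
  have each: "(\<kappa> k * \<eta> / 9) ^ (d - 1) * \<bar>poly q (cos (\<alpha> k)) - poly q (cos (\<beta> k))\<bar> \<le> A (k - 1) + A k + A (Suc k)"
    if k: "k \<in> ?K" for k
  proof -
    let ?u = "(real k - 1) * \<eta>" and ?v = "(real k + 2) * \<eta>"
    have km: "real k + 2 \<le> real m" "2 \<le> real k" "real k + 3 \<le> real m" using k by auto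
    have u0: "0 \<le> ?u" using km \<eta> by simp
    have vpi: "?v \<le> pi" using mult_right_mono[OF km(1), of \<eta>] \<eta> by simp
    have sn: "\<kappa> k * \<eta> / 9 \<le> sin \<theta>" if \<theta>: "\<theta> \<in> {?u..?v}" for \<theta>
    proof -
      \<comment> \<open>Here k + 1 \<le> 3 (k - 1) since k \<ge> 2, and m - k \<le> 3 (m - k - 2)
        since m - k \<ge> 3. This third and the one in the lower bound for the sine make up the
        9.\<close>
      have "\<kappa> k / 3 \<le> real k - 1" "\<kappa> k / 3 \<le> real m - (real k + 2)"
        using km k by (auto simp: \<kappa>_def min_def of_nat_diff)
      then have "\<kappa> k / 3 * \<eta> \<le> ?u" "\<kappa> k / 3 * \<eta> \<le> (real m - (real k + 2)) * \<eta>"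
        using \<eta> by (auto intro!: mult_right_mono)
      moreover have "(real m - (real k + 2)) * \<eta> = pi - ?v" using \<eta>(2) by (simp add: left_diff_distrib)
      ultimately have "\<kappa> k / 3 * \<eta> \<le> min \<theta> (pi - \<theta>)" using \<theta> by auto
      moreover have "min \<theta> (pi - \<theta>) / 3 \<le> sin \<theta>"
        using \<theta> u0 vpi by (intro sin_ge_min_third) auto
      moreover have "\<kappa> k * \<eta> / 9 = (\<kappa> k / 3 * \<eta>) / 3" by simp
      ultimately show ?thesis by (metis divide_right_mono order_trans zero_le_numeral)
    qed
    have "(\<kappa> k * \<eta> / 9) ^ (d - 1) * \<bar>poly q (cos (\<alpha> k)) - poly q (cos (\<beta> k))\<bar> \<le> integral {?u..?v} \<phi>"
      unfolding \<phi>_def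
      by (rule diff_poly_cos_le_integral[OF assms(1) u0 vpi])
        (use near[OF k] sn \<eta> in \<open>auto simp: \<eta>_def[symmetric] \<kappa>_def\<close>)
    also have "integral {?u..?v} \<phi> = integral {?u..real k * \<eta>} \<phi> + integral {real k * \<eta>..?v} \<phi>"
      using \<eta> by (intro Henstock_Kurzweil_Integration.integral_combine[symmetric] int) (auto simp: algebra_simps)
    also have "integral {real k * \<eta>..?v} \<phi> = integral {real k * \<eta>..(real k + 1) * \<eta>} \<phi> + integral {(real k + 1) * \<eta>..?v} \<phi>"
      using \<eta> by (intro Henstock_Kurzweil_Integration.integral_combine[symmetric] int) (auto simp: algebra_simps)
    also have "integral {?u..real k * \<eta>} \<phi> + (integral {real k * \<eta>..(real k + 1) * \<eta>} \<phi> + integral {(real k + 1) * \<eta>..?v} \<phi>)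
        = A (k - 1) + A k + A (Suc k)"
      using k by (simp add: A_def of_nat_diff add.commute add.left_commute)
    finally show ?thesis .
  qed
  have "(\<Sum>k\<in>?K. (\<kappa> k * \<eta> / 9) ^ (d - 1) * \<bar>poly q (cos (\<alpha> k)) - poly q (cos (\<beta> k))\<bar>)
      \<le> (\<Sum>k\<in>?K. A (k - 1) + A k + A (Suc k))"
    by (intro sum_mono each)
  also have "\<dots> \<le> 3 * V"
  proof -
    have "(\<Sum>k\<in>?K. A (k - 1)) \<le> V" by (rule shift) (auto simp: inj_on_def)
    moreover have "(\<Sum>k\<in>?K. A k) \<le> V" by (rule shift) auto
    moreover have "(\<Sum>k\<in>?K. A (Suc k)) \<le> V" by (rule shift) auto
    ultimately show ?thesis by (simp add: sum.distrib)
  qed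
  finally have main: "(\<Sum>k\<in>?K. (\<kappa> k * \<eta> / 9) ^ (d - 1) * \<bar>poly q (cos (\<alpha> k)) - poly q (cos (\<beta> k))\<bar>) \<le> 3 * V" .
  have "(\<Sum>k\<in>?K. \<kappa> k ^ (d - 1) * \<bar>poly q (cos (\<alpha> k)) - poly q (cos (\<beta> k))\<bar>) =
     (9 / \<eta>) ^ (d - 1) * (\<Sum>k\<in>?K. (\<kappa> k * \<eta> / 9) ^ (d - 1) * \<bar>poly q (cos (\<alpha> k)) - poly q (cos (\<beta> k))\<bar>)"
    unfolding sum_distrib_left mult.assoc[symmetric] power_mult_distrib[symmetric] using \<eta> by simp
  also have "\<dots> \<le> (9 / \<eta>) ^ (d - 1) * (3 * V)"
    using main \<eta> by (intro mult_left_mono) auto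
  also have "\<dots> \<le> (5 * real m) ^ (d - 1) * (3 * V)"
  proof (intro mult_right_mono power_mono)
    \<comment> \<open>9 / \<eta> = 9 m / \<pi>, and already \<pi> \<ge> 2 gives 9 m / 2.\<close>
    show "9 / \<eta> \<le> 5 * real m"
      using pi_ge_two assms(2) by (simp add: \<eta>_def field_simps)
    have "0 \<le> integral {0..pi} \<phi>" by (intro integral_nonneg int \<phi>0) auto
    then show "0 \<le> 3 * V" using V by (simp add: \<phi>_def[abs_def])
  qed (use \<eta> in auto)
  finally show ?thesis by (simp add: \<kappa>_def)
qed

lemma continuous_on_polar_angle:
  fixes e :: "'a::euclidean_space"
  assumes "norm e = 1"
  shows "continuous_on (sphere 0 1) (\<lambda>x. arccos (x \<bullet> e))"
proof (intro continuous_on_arccos continuous_intros ballI)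
  fix x :: 'a assume "x \<in> sphere 0 1"
  then show "- 1 \<le> x \<bullet> e \<and> x \<bullet> e \<le> 1"
    using Cauchy_Schwarz_ineq2[of x e] assms by (simp add: abs_le_iff)
qed

section \<open>Nets on the equator\<close>

text \<open>Volume packing: the balls of radius \<delta>/2 about the points are disjoint and lie in
  the ball of radius R.\<close>

lemma card_separated_le:
  fixes T :: "'a::euclidean_space set"
  assumes "finite T" "0 < \<delta>" "0 \<le> R"
    and bd: "\<And>x. x \<in> T \<Longrightarrow> norm x + \<delta> / 2 \<le> R"
    and sep: "\<And>x y. x \<in> T \<Longrightarrow> y \<in> T \<Longrightarrow> x \<noteq> y \<Longrightarrow> \<delta> \<le> dist x y"
  shows "real (card T) \<le> (2 * R / \<delta>) ^ DIM('a)"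
proof (cases "T = {}")
  case True
  then show ?thesis using assms by simp
next
  case False
  let ?v = "measure lborel (ball (0::'a) 1)"
  have v: "?v > 0" by (rule content_ball_pos) simp
  have vol: "measure lborel (ball c r) = r ^ DIM('a) * ?v" if "r \<ge> 0" for c :: 'a and r
    by (rule content_ball_conv_unit_ball[OF that])
  have "measure lborel (\<Union>x\<in>T. ball x (\<delta> / 2)) = (\<Sum>x\<in>T. measure lborel (ball x (\<delta> / 2)))"
  proof (rule measure_finite_Union[OF assms(1)])
    show "disjoint_family_on (\<lambda>x. ball x (\<delta> / 2)) T"
      unfolding disjoint_family_on_def
    proof (intro ballI impI)
      fix x y assume "x \<in> T" "y \<in> T" "x \<noteq> y"
      then have d: "\<delta> \<le> dist x y" by (rule sep)
      show "ball x (\<delta> / 2) \<inter> ball y (\<delta> / 2) = {}"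
      proof (rule ccontr)
        assume "ball x (\<delta> / 2) \<inter> ball y (\<delta> / 2) \<noteq> {}"
        then obtain z where "dist x z < \<delta> / 2" "dist y z < \<delta> / 2" by auto
        then have "dist x y < \<delta>" using dist_triangle2[of x y z] by linarith
        with d show False by simp
      qed
    qed
    show "emeasure lborel (ball x (\<delta> / 2)) \<noteq> \<infinity>" for x
      using emeasure_lborel_ball_finite[of x "\<delta> / 2"] by simp
  qed auto
  also have "\<dots> = real (card T) * ((\<delta> / 2) ^ DIM('a) * ?v)"
    using assms(2) vol[of "\<delta> / 2"] by simp
  finally have "real (card T) * ((\<delta> / 2) ^ DIM('a) * ?v) = measure lborel (\<Union>x\<in>T. ball x (\<delta> / 2))" ..
  also have "\<dots> \<le> measure lborel (ball (0::'a) R)"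
  proof -
    have "(\<Union>x\<in>T. ball x (\<delta> / 2)) \<subseteq> ball 0 R"
    proof
      fix y assume "y \<in> (\<Union>x\<in>T. ball x (\<delta> / 2))"
      then obtain x where "x \<in> T" "dist x y < \<delta> / 2" by auto
      then show "y \<in> ball 0 R" using bd[of x] norm_triangle_sub[of y x] by (simp add: dist_norm norm_minus_commute)
    qed
    then have "emeasure lborel (\<Union>x\<in>T. ball x (\<delta> / 2)) \<le> emeasure lborel (ball (0::'a) R)"
      by (intro emeasure_mono) auto
    then show ?thesis
      unfolding measure_def using emeasure_lborel_ball_finite[of "0::'a" R] by (intro enn2real_mono) auto
  qed
  also have "\<dots> = R ^ DIM('a) * ?v" by (rule vol) fact
  finally have "real (card T) * (\<delta> / 2) ^ DIM('a) \<le> R ^ DIM('a)"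
    using v by (simp add: mult.assoc[symmetric])
  then have "real (card T) \<le> R ^ DIM('a) / (\<delta> / 2) ^ DIM('a)"
    using assms(2) by (simp add: pos_le_divide_eq)
  then show ?thesis by (simp add: power_divide[symmetric] mult.commute)
qed

text \<open>
  The points \<open>j \<delta> \<omega> + l \<delta> e\<close> with \<open>\<omega>\<close> in a separated subset of the equator turn the packing problem
  on the equator into one in the ambient space, at the price of two dimensions.
\<close>

lemma card_separated_equator_le:
  fixes e :: "'a::euclidean_space"
  assumes "norm e = 1" "DIM('a) \<ge> 2" "0 < \<delta>" "\<delta> \<le> 1" "finite P"
    and P: "P \<subseteq> {\<omega>. norm \<omega> = 1 \<and> \<omega> \<bullet> e = 0}"
    and sep: "\<And>x y. x \<in> P \<Longrightarrow> y \<in> P \<Longrightarrow> x \<noteq> y \<Longrightarrow> \<delta> \<le> dist x y"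
  shows "real (card P) \<le> 9 ^ DIM('a) * (1 / \<delta>) ^ (DIM('a) - 2)"
proof -
  define m where "m = nat \<lceil>1 / \<delta>\<rceil>"
  have m: "1 / \<delta> \<le> real m" "real m \<le> 1 / \<delta> + 1"
    using assms(3) unfolding m_def by (simp_all add: ceiling_correct le_of_int_ceiling of_nat_nat)
  have m': "1 \<le> real m * \<delta>" "real m * \<delta> \<le> 1 + \<delta>"
    using m assms(3) by (simp_all add: field_simps)
  define \<Phi> where "\<Phi> z = (case z of (\<omega>, j, l) \<Rightarrow> (real j * \<delta>) *\<^sub>R \<omega> + (real l * \<delta>) *\<^sub>R e)" for z
  \<comment> \<open>Radii j \<delta> with j \<ge> m are at least 1, so scaling does not shrink the
    separation of \<open>P\<close>. The m^2 \<ge> 1/\<delta>^2 copies account for the two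
    dimensions.\<close>
  define I where "I = P \<times> {m..<2*m} \<times> {..<m}"
  have sepI: "\<delta> \<le> dist (\<Phi> z) (\<Phi> z')" if z: "z \<in> I" "z' \<in> I" "z \<noteq> z'" for z z'
  proof -
    obtain \<omega> j l \<omega>' j' l' where zz: "z = (\<omega>, j, l)" "z' = (\<omega>', j', l')" by (metis prod.exhaust)
    have \<omega>: "norm \<omega> = 1" "\<omega> \<bullet> e = 0" "norm \<omega>' = 1" "\<omega>' \<bullet> e = 0" "\<omega> \<in> P" "\<omega>' \<in> P"
      using z(1,2) P by (auto simp: zz I_def)
    let ?a = "(real j * \<delta>) *\<^sub>R \<omega> - (real j' * \<delta>) *\<^sub>R \<omega>'" and ?b = "(real l - real l') * \<delta>"
    have "\<Phi> z - \<Phi> z' = ?a + ?b *\<^sub>R e" by (simp add: \<Phi>_def zz algebra_simps)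
    moreover have "orthogonal ?a (?b *\<^sub>R e)" using \<omega> by (simp add: orthogonal_def inner_diff_left)
    \<comment> \<open>By orthogonality it suffices that either the heights or the equatorial parts
      are \<delta> apart. With equal heights, unequal radii separate by the reverse triangle
      inequality, and equal radii by the separation of \<open>P\<close>.\<close>
    ultimately have sq: "(dist (\<Phi> z) (\<Phi> z'))\<^sup>2 = (norm ?a)\<^sup>2 + ?b\<^sup>2"
      using assms(1) by (simp add: dist_norm norm_add_Pythagorean)
    have "\<delta>\<^sup>2 \<le> (norm ?a)\<^sup>2 + ?b\<^sup>2"
    proof (cases "l = l'")
      case False
      have "1 \<le> \<bar>real l - real l'\<bar>" using False by linarith
      then have "\<delta> \<le> \<bar>?b\<bar>" using assms(3) by (simp add: abs_mult)
      then have "\<delta>\<^sup>2 \<le> ?b\<^sup>2" using assms(3) by (metis abs_of_pos abs_le_square_iff)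
      then show ?thesis by (simp add: add_increasing)
    next
      case l: True
      have "\<delta> \<le> norm ?a"
      proof (cases "j = j'")
        case True
        then have "\<omega> \<noteq> \<omega>'" using z(3) l zz by auto
        then have "\<delta> \<le> dist \<omega> \<omega>'" using sep \<omega> by blast
        moreover have "1 \<le> real j * \<delta>"
        proof -
          have "real m * \<delta> \<le> real j * \<delta>" using z(1) assms(3) by (intro mult_right_mono) (auto simp: zz I_def)
          then show ?thesis using m' by simp
        qed
        ultimately have "1 * \<delta> \<le> (real j * \<delta>) * dist \<omega> \<omega>'" using assms(3) by (intro mult_mono) auto
        also have "\<dots> = norm ?a" using True assms(3) by (simp add: dist_norm scaleR_diff_right[symmetric] abs_of_pos)
        finally show ?thesis by simp
      next
        case False
        have "1 \<le> \<bar>real j - real j'\<bar>" using False by linarith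
        then have "\<delta> \<le> \<bar>real j - real j'\<bar> * \<delta>" using assms(3) by simp
        also have "\<dots> = \<bar>norm ((real j * \<delta>) *\<^sub>R \<omega>) - norm ((real j' * \<delta>) *\<^sub>R \<omega>')\<bar>"
          using \<omega> assms(3) by (simp add: abs_mult left_diff_distrib[symmetric])
        also have "\<dots> \<le> norm ?a" by (rule norm_triangle_ineq3)
        finally show ?thesis .
      qed
      then have "\<delta>\<^sup>2 \<le> (norm ?a)\<^sup>2" using assms(3) by (intro power_mono) auto
      then show ?thesis by (simp add: add_increasing2)
    qed
    then have "\<delta>\<^sup>2 \<le> (dist (\<Phi> z) (\<Phi> z'))\<^sup>2" using sq by simp
    then show ?thesis by (rule power2_le_imp_le) simp
  qed
  have inj: "inj_on \<Phi> I"
    by (rule inj_onI) (metis sepI assms(3) dist_self not_le)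
  \<comment> \<open>The radius is 9/2 because j + l \<le> 3m - 2 gives norm at most 3 + \<delta>,
    and 3 + \<delta> + \<delta>/2 \<le> 9/2.\<close>
  have "real (card (\<Phi> ` I)) \<le> (2 * (9 / 2) / \<delta>) ^ DIM('a)"
  proof (rule card_separated_le)
    show "finite (\<Phi> ` I)" using assms(5) by (simp add: I_def)
    show "\<delta> \<le> dist x y" if "x \<in> \<Phi> ` I" "y \<in> \<Phi> ` I" "x \<noteq> y" for x y
      using that sepI by blast
    show "norm x + \<delta> / 2 \<le> 9 / 2" if x: "x \<in> \<Phi> ` I" for x
    proof -
      obtain \<omega> j l where z: "(\<omega>, j, l) \<in> I" "x = (real j * \<delta>) *\<^sub>R \<omega> + (real l * \<delta>) *\<^sub>R e"
        using x by (auto simp: \<Phi>_def)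
      have \<omega>: "norm \<omega> = 1" using z P by (auto simp: I_def)
      have "norm x \<le> real j * \<delta> + real l * \<delta>"
        using norm_triangle_ineq[of "(real j * \<delta>) *\<^sub>R \<omega>" "(real l * \<delta>) *\<^sub>R e"] \<omega> assms(1,3) z(2) by simp
      also have "\<dots> = real (j + l) * \<delta>" by (simp add: algebra_simps)
      also have "\<dots> \<le> (3 * real m - 2) * \<delta>"
        using z(1) assms(3) by (intro mult_right_mono) (auto simp: I_def)
      also have "\<dots> = 3 * (real m * \<delta>) - 2 * \<delta>" by (simp add: algebra_simps)
      also have "\<dots> \<le> 3 + \<delta>" using m' by simp
      finally show ?thesis using assms(4) by simp
    qed
  qed (use assms(3) in auto)
  then have "real (card P) * (real m * real m) \<le> (9 / \<delta>) ^ DIM('a)"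
    by (simp add: card_image[OF inj]) (simp add: I_def card_cartesian_product mult.assoc)
  moreover have "real (card P) * (1 / \<delta> * (1 / \<delta>)) \<le> real (card P) * (real m * real m)"
    using m assms(3) by (intro mult_left_mono mult_mono) auto
  ultimately have "real (card P) * (1 / \<delta> * (1 / \<delta>)) \<le> (9 / \<delta>) ^ DIM('a)" by simp
  moreover have "(9 / \<delta>) ^ DIM('a) = 9 ^ DIM('a) * (1 / \<delta>) ^ (DIM('a) - 2) * (1 / \<delta> * (1 / \<delta>))"
  proof -
    obtain k where k: "DIM('a) = Suc (Suc k)" using assms(2) by (metis add_2_eq_Suc le_Suc_ex)
    show ?thesis unfolding k by (simp add: power_divide)
  qed
  ultimately have "real (card P) * (1 / \<delta> * (1 / \<delta>)) \<le>
      9 ^ DIM('a) * (1 / \<delta>) ^ (DIM('a) - 2) * (1 / \<delta> * (1 / \<delta>))" by simp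
  then show ?thesis by (rule mult_right_le_imp_le) (use assms(3) in simp)
qed

text \<open>A \<delta>-separated subset of maximal cardinality is a \<delta>-net, since a point
  farther than \<delta> from it could be added. The packing bound ensures that a maximum
  exists.\<close>

lemma equator_net:
  fixes e :: "'a::euclidean_space"
  assumes "norm e = 1" "DIM('a) \<ge> 2" "0 < \<delta>" "\<delta> \<le> 1"
  obtains P where "finite P" "P \<subseteq> {\<omega>. norm \<omega> = 1 \<and> \<omega> \<bullet> e = 0}"
    "real (card P) \<le> 9 ^ DIM('a) * (1 / \<delta>) ^ (DIM('a) - 2)"
    "\<And>\<omega>. norm \<omega> = 1 \<Longrightarrow> \<omega> \<bullet> e = 0 \<Longrightarrow> \<exists>\<omega>'\<in>P. dist \<omega> \<omega>' \<le> \<delta>"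
proof -
  define S where "S = {\<omega>. norm \<omega> = 1 \<and> \<omega> \<bullet> e = 0}"
  define good where "good P \<longleftrightarrow> finite P \<and> P \<subseteq> S \<and> (\<forall>x\<in>P. \<forall>y\<in>P. x \<noteq> y \<longrightarrow> \<delta> \<le> dist x y)" for P
  let ?B = "9 ^ DIM('a) * (1 / \<delta>) ^ (DIM('a) - 2)"
  have bound: "real (card P) \<le> ?B" if "good P" for P
    by (rule card_separated_equator_le[OF assms]) (use that in \<open>auto simp: good_def S_def\<close>)
  have "good {}" by (simp add: good_def)
  moreover have "\<forall>P. good P \<longrightarrow> card P \<le> nat \<lfloor>?B\<rfloor>"
    using bound le_nat_floor by blast
  ultimately obtain P where P: "good P" "\<And>Q. good Q \<Longrightarrow> card Q \<le> card P"
    using Lattices_Big.ex_has_greatest_nat[of good "{}" card "Suc (nat \<lfloor>?B\<rfloor>)"]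
    by (auto simp: less_Suc_eq_le)
  have "\<exists>\<omega>'\<in>P. dist \<omega> \<omega>' \<le> \<delta>" if "\<omega> \<in> S" for \<omega>
  proof (rule ccontr)
    assume "\<not> ?thesis"
    then have far: "\<And>\<omega>'. \<omega>' \<in> P \<Longrightarrow> \<delta> < dist \<omega> \<omega>'" by force
    then have new: "\<omega> \<notin> P" using assms(3) by force
    have "good (insert \<omega> P)" using P(1) that far unfolding good_def
      by (auto simp: dist_commute less_imp_le)
    from P(2)[OF this] show False using P(1) new by (simp add: good_def)
  qed
  then show ?thesis using that[of P] bound[OF P(1)] P(1) by (auto simp: good_def S_def)
qed

section \<open>The polar angle and the total oscillation over zones\<close>

text \<open>Away from the poles the direction is the normalized projection to the equatorial
  hyperplane. At the poles the sine vanishes and any unit vector orthogonal to \<open>e\<close>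
  serves, which exists in dimension at least 2.\<close>

lemma polar_decomposition:
  fixes e x :: "'a::euclidean_space"
  assumes "norm e = 1" "DIM('a) \<ge> 2" "norm x = 1"
  obtains \<omega> where "norm \<omega> = 1" "\<omega> \<bullet> e = 0" "x = cos (arccos (x \<bullet> e)) *\<^sub>R e + sin (arccos (x \<bullet> e)) *\<^sub>R \<omega>"
proof -
  let ?t = "x \<bullet> e"
  have t: "\<bar>?t\<bar> \<le> 1" using Cauchy_Schwarz_ineq2[of x e] assms by simp
  have c: "cos (arccos ?t) = ?t" using t by (simp add: abs_le_iff)
  have s: "sin (arccos ?t) = sqrt (1 - ?t\<^sup>2)" using t by (simp add: sin_arccos_abs)
  have ee: "e \<bullet> e = 1" "x \<bullet> x = 1" using assms by (simp_all add: dot_square_norm)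
  have n: "norm (x - ?t *\<^sub>R e) = sqrt (1 - ?t\<^sup>2)"
    unfolding norm_eq_sqrt_inner
    by (simp add: inner_diff_left inner_diff_right ee inner_commute power2_eq_square)
  show thesis
  proof (cases "sqrt (1 - ?t\<^sup>2) = 0")
    case True
    obtain y where y: "y \<noteq> 0" "orthogonal e y" using orthogonal_to_vector_exists[OF assms(2)] by blast
    have "x = ?t *\<^sub>R e" using n True by simp
    then show ?thesis
      using that[of "y /\<^sub>R norm y"] y s True c by (simp add: orthogonal_def inner_commute)
  next
    case False
    let ?\<omega> = "(x - ?t *\<^sub>R e) /\<^sub>R sqrt (1 - ?t\<^sup>2)"
    have "\<bar>sqrt (1 - ?t\<^sup>2)\<bar> = sqrt (1 - ?t\<^sup>2)" using t by (simp add: abs_square_le_1)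
    then have "norm ?\<omega> = 1" using False n by (simp add: norm_scaleR abs_inverse)
    moreover have "?\<omega> \<bullet> e = 0" by (simp add: inner_diff_left ee)
    moreover have "x = cos (arccos ?t) *\<^sub>R e + sin (arccos ?t) *\<^sub>R ?\<omega>"
      unfolding c s using False by simp
    ultimately show ?thesis by (rule that)
  qed
qed

lemma arccos_inner_unit:
  fixes e x :: "'a::euclidean_space"
  assumes "norm e = 1" "norm x = 1"
  shows "0 \<le> arccos (x \<bullet> e)" "arccos (x \<bullet> e) \<le> pi" "cos (arccos (x \<bullet> e)) = x \<bullet> e"
proof -
  have "\<bar>x \<bullet> e\<bar> \<le> 1" using Cauchy_Schwarz_ineq2[of x e] assms by simp
  then show "0 \<le> arccos (x \<bullet> e)" "arccos (x \<bullet> e) \<le> pi" "cos (arccos (x \<bullet> e)) = x \<bullet> e"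
    by (simp_all add: abs_le_iff arccos_lbound arccos_ubound)
qed

text \<open>
  The weight \<open>min (k + 1) (m - k)\<close> is, in units of the mesh size, the radius of the \<open>k\<close>-th zone.
\<close>

lemma sum_oscillation_le:
  fixes e :: "'a::euclidean_space" and g :: "'a \<Rightarrow> real" and Q :: "nat \<Rightarrow> real poly" and x y :: "nat \<Rightarrow> 'a"
  assumes "norm e = 1" "d \<ge> 1" "m \<ge> 1"
    and cont: "continuous_on (sphere 0 1) g" and B: "\<And>x. norm x = 1 \<Longrightarrow> \<bar>g x\<bar> \<le> B"
    and lim: "AE x in surface_measure. (\<lambda>j. poly (Q j) (x \<bullet> e)) \<longlonglongrightarrow> g x"
    and V: "\<And>j. integral {0..pi} (\<lambda>\<theta>. \<bar>poly (pderiv (Q j)) (cos \<theta>)\<bar> * sin \<theta> ^ d) \<le> V"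
    and zone: "\<And>k. k < m \<Longrightarrow> norm (x k) = 1 \<and> norm (y k) = 1 \<and>
      arccos (x k \<bullet> e) \<in> {real k * (pi / m)..(real k + 1) * (pi / m)} \<and>
      arccos (y k \<bullet> e) \<in> {real k * (pi / m)..(real k + 1) * (pi / m)}"
  shows "(\<Sum>k<m. real (min (k + 1) (m - k)) ^ (d - 1) * \<bar>g (x k) - g (y k)\<bar>)
     \<le> (5 ^ (d - 1) * (3 * V) + 1 + 8 * B * 2 ^ (d - 1)) * real m ^ (d - 1)"
proof -
  define \<eta> where "\<eta> = pi / real m"
  define \<kappa> where "\<kappa> k = real (min (k + 1) (m - k)) ^ (d - 1)" for k
  \<comment> \<open>Four approximations cost 4 \<rho> per zone, so m zones together cost 1; this is
    the summand 1 in the constant.\<close>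
  define \<rho> where "\<rho> = 1 / (4 * real m)"
  have \<eta>: "\<eta> > 0" and \<rho>: "\<rho> > 0" using assms(3) by (simp_all add: \<eta>_def \<rho>_def)
  have B0: "B \<ge> 0" using B[of e] assms(1) by linarith
  have \<kappa>0: "0 \<le> \<kappa> k" for k by (simp add: \<kappa>_def)
  let ?K = "{2..<m-2}"
  \<comment> \<open>The points of convergence are dense, and \<open>g\<close> and the polar angle
    are continuous, so a point can be replaced at a small cost in value and a shift of less than one
    zone.\<close>
  have approx: "\<exists>z'. norm z' = 1 \<and> \<bar>g z' - g z\<bar> < \<rho> \<and> \<bar>arccos (z' \<bullet> e) - arccos (z \<bullet> e)\<bar> < \<eta> \<and>
      (\<lambda>j. poly (Q j) (z' \<bullet> e)) \<longlonglongrightarrow> g z'" if z: "norm z = 1" for z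
  proof -
    have zs: "z \<in> sphere 0 1" using z by simp
    obtain \<delta>1 where d1: "\<delta>1 > 0" "\<And>z'. z' \<in> sphere 0 1 \<Longrightarrow> dist z' z < \<delta>1 \<Longrightarrow> dist (g z') (g z) < \<rho>"
      using cont zs \<rho> unfolding continuous_on_iff by meson
    obtain \<delta>2 where d2: "\<delta>2 > 0" "\<And>z'. z' \<in> sphere 0 1 \<Longrightarrow> dist z' z < \<delta>2 \<Longrightarrow> dist (arccos (z' \<bullet> e)) (arccos (z \<bullet> e)) < \<eta>"
      using continuous_on_polar_angle[OF assms(1)] zs \<eta> unfolding continuous_on_iff by meson
    obtain z' where z': "z' \<in> sphere 0 1" "(\<lambda>j. poly (Q j) (z' \<bullet> e)) \<longlonglongrightarrow> g z'" "dist z' z < min \<delta>1 \<delta>2"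
      using AE_surface_measure_dense[OF lim zs, of "min \<delta>1 \<delta>2"] d1(1) d2(1) by auto
    then show ?thesis using d1(2)[of z'] d2(2)[of z'] by (intro exI[of _ z']) (simp add: dist_real_def)
  qed
  have "\<forall>k\<in>?K. \<exists>z'. norm z' = 1 \<and> \<bar>g z' - g (x k)\<bar> < \<rho> \<and> \<bar>arccos (z' \<bullet> e) - arccos (x k \<bullet> e)\<bar> < \<eta> \<and>
      (\<lambda>j. poly (Q j) (z' \<bullet> e)) \<longlonglongrightarrow> g z'"
    using approx zone by auto
  then obtain x' where x': "\<And>k. k \<in> ?K \<Longrightarrow> norm (x' k) = 1 \<and> \<bar>g (x' k) - g (x k)\<bar> < \<rho> \<and>
      \<bar>arccos (x' k \<bullet> e) - arccos (x k \<bullet> e)\<bar> < \<eta> \<and> (\<lambda>j. poly (Q j) (x' k \<bullet> e)) \<longlonglongrightarrow> g (x' k)"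
    by metis
  have "\<forall>k\<in>?K. \<exists>z'. norm z' = 1 \<and> \<bar>g z' - g (y k)\<bar> < \<rho> \<and> \<bar>arccos (z' \<bullet> e) - arccos (y k \<bullet> e)\<bar> < \<eta> \<and>
      (\<lambda>j. poly (Q j) (z' \<bullet> e)) \<longlonglongrightarrow> g z'"
    using approx zone by auto
  then obtain y' where y': "\<And>k. k \<in> ?K \<Longrightarrow> norm (y' k) = 1 \<and> \<bar>g (y' k) - g (y k)\<bar> < \<rho> \<and>
      \<bar>arccos (y' k \<bullet> e) - arccos (y k \<bullet> e)\<bar> < \<eta> \<and> (\<lambda>j. poly (Q j) (y' k \<bullet> e)) \<longlonglongrightarrow> g (y' k)"
    by metis
  \<comment> \<open>There are only finitely many zones, so pointwise convergence at the selected
    points yields one index \<open>j\<close> for all of them.\<close>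
  have "\<forall>\<^sub>F j in sequentially. \<forall>k\<in>?K. dist (poly (Q j) (x' k \<bullet> e)) (g (x' k)) < \<rho> \<and> dist (poly (Q j) (y' k \<bullet> e)) (g (y' k)) < \<rho>"
    using x' y' \<rho> by (intro eventually_ball_finite ballI eventually_conj tendstoD) auto
  then obtain j where j: "\<And>k. k \<in> ?K \<Longrightarrow> dist (poly (Q j) (x' k \<bullet> e)) (g (x' k)) < \<rho> \<and> dist (poly (Q j) (y' k \<bullet> e)) (g (y' k)) < \<rho>"
    using eventually_happens by force
  define \<alpha> \<beta> where "\<alpha> k = arccos (x' k \<bullet> e)" and "\<beta> k = arccos (y' k \<bullet> e)" for k
  have inner: "(\<Sum>k\<in>?K. \<kappa> k * \<bar>poly (Q j) (cos (\<alpha> k)) - poly (Q j) (cos (\<beta> k))\<bar>) \<le> (5 * real m) ^ (d - 1) * (3 * V)"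
    unfolding \<kappa>_def
  proof (rule sum_poly_cos_oscillation_le[OF assms(2,3) V])
    fix k assume k: "k \<in> ?K"
    then have km: "k < m" by auto
    have eq: "(real k - 1) * \<eta> = real k * \<eta> - \<eta>" "(real k + 2) * \<eta> = (real k + 1) * \<eta> + \<eta>"
      by (simp_all add: algebra_simps)
    have widen: "a' \<in> {l - \<eta>..u + \<eta>}" if "a \<in> {l..u}" "\<bar>a' - a\<bar> < \<eta>" for a a' l u :: real
      using that by auto
    have "\<alpha> k \<in> {(real k - 1) * \<eta>..(real k + 2) * \<eta>}" "\<beta> k \<in> {(real k - 1) * \<eta>..(real k + 2) * \<eta>}"
      using zone[OF km, folded \<eta>_def] x'[OF k] y'[OF k] unfolding \<alpha>_def \<beta>_def eq by (blast intro: widen)+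
    then show "\<alpha> k \<in> {(real k - 1) * (pi / real m)..(real k + 2) * (pi / real m)} \<and>
       \<beta> k \<in> {(real k - 1) * (pi / real m)..(real k + 2) * (pi / real m)}"
      by (simp add: \<eta>_def)
  qed
  have \<kappa>m: "\<kappa> k \<le> real m ^ (d - 1)" if "k < m" for k
    unfolding \<kappa>_def using that by (intro power_mono) auto
  have close: "\<bar>g (x k) - g (y k)\<bar> \<le> \<bar>poly (Q j) (cos (\<alpha> k)) - poly (Q j) (cos (\<beta> k))\<bar> + 4 * \<rho>" if k: "k \<in> ?K" for k
  proof -
    have "cos (\<alpha> k) = x' k \<bullet> e" "cos (\<beta> k) = y' k \<bullet> e"
      using x'[OF k] y'[OF k] by (simp_all add: \<alpha>_def \<beta>_def arccos_inner_unit[OF assms(1)])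
    moreover have "\<bar>a - b\<bar> \<le> \<bar>p - q\<bar> + 4 * r"
      if "\<bar>a' - a\<bar> < r" "\<bar>b' - b\<bar> < r" "\<bar>p - a'\<bar> < r" "\<bar>q - b'\<bar> < r" for a b p q r a' b' :: real
      using that by linarith
    ultimately show ?thesis using x'[OF k] y'[OF k] j[OF k, unfolded dist_real_def] by metis
  qed
  have "(\<Sum>k\<in>?K. \<kappa> k * \<bar>g (x k) - g (y k)\<bar>) \<le>
      (\<Sum>k\<in>?K. \<kappa> k * \<bar>poly (Q j) (cos (\<alpha> k)) - poly (Q j) (cos (\<beta> k))\<bar> + real m ^ (d - 1) * (4 * \<rho>))"
  proof (rule sum_mono)
    fix k assume k: "k \<in> ?K"
    then have "k < m" by auto
    have "\<kappa> k * \<bar>g (x k) - g (y k)\<bar> \<le> \<kappa> k * (\<bar>poly (Q j) (cos (\<alpha> k)) - poly (Q j) (cos (\<beta> k))\<bar> + 4 * \<rho>)"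
      by (intro mult_left_mono close k \<kappa>0)
    also have "\<dots> = \<kappa> k * \<bar>poly (Q j) (cos (\<alpha> k)) - poly (Q j) (cos (\<beta> k))\<bar> + \<kappa> k * (4 * \<rho>)"
      by (simp only: distrib_left)
    also have "\<kappa> k * (4 * \<rho>) \<le> real m ^ (d - 1) * (4 * \<rho>)"
      using \<rho> \<kappa>m[OF \<open>k < m\<close>] by (intro mult_right_mono) auto
    finally show "\<kappa> k * \<bar>g (x k) - g (y k)\<bar> \<le>
       \<kappa> k * \<bar>poly (Q j) (cos (\<alpha> k)) - poly (Q j) (cos (\<beta> k))\<bar> + real m ^ (d - 1) * (4 * \<rho>)" by simp
  qed
  also have "\<dots> = (\<Sum>k\<in>?K. \<kappa> k * \<bar>poly (Q j) (cos (\<alpha> k)) - poly (Q j) (cos (\<beta> k))\<bar>) +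
      real (card ?K) * (real m ^ (d - 1) * (4 * \<rho>))"
    by (simp add: sum.distrib)
  also have "\<dots> \<le> (5 * real m) ^ (d - 1) * (3 * V) + real m * (real m ^ (d - 1) * (4 * \<rho>))"
    using inner \<rho> by (intro add_mono mult_right_mono) auto
  also have "\<dots> = (5 ^ (d - 1) * (3 * V) + 1) * real m ^ (d - 1)"
    using assms(3) by (simp add: \<rho>_def power_mult_distrib algebra_simps)
  finally have int: "(\<Sum>k\<in>?K. \<kappa> k * \<bar>g (x k) - g (y k)\<bar>) \<le> (5 ^ (d - 1) * (3 * V) + 1) * real m ^ (d - 1)" .
  \<comment> \<open>At most four zones, two at each pole: the weight is at most 2^(d-1) and the
    oscillation at most 2 B, giving 8 B 2^(d-1).\<close>
  have "(\<Sum>k\<in>{..<m} - ?K. \<kappa> k * \<bar>g (x k) - g (y k)\<bar>) \<le> (\<Sum>k\<in>{..<m} - ?K. 2 ^ (d - 1) * (2 * B))"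
  proof (rule sum_mono)
    fix k assume k: "k \<in> {..<m} - ?K"
    have "\<kappa> k \<le> 2 ^ (d - 1)" unfolding \<kappa>_def using k by (intro power_mono) auto
    moreover have "\<bar>g (x k) - g (y k)\<bar> \<le> 2 * B"
      using B[of "x k"] B[of "y k"] zone[of k] k by force
    ultimately show "\<kappa> k * \<bar>g (x k) - g (y k)\<bar> \<le> 2 ^ (d - 1) * (2 * B)"
      by (intro mult_mono) auto
  qed
  also have "\<dots> = real (card ({..<m} - ?K)) * (2 ^ (d - 1) * (2 * B))" by simp
  also have "\<dots> \<le> 4 * (2 ^ (d - 1) * (2 * B))"
  proof (rule mult_right_mono)
    have "{..<m} - ?K \<subseteq> {0, 1, m - 2, m - 1}" by auto
    then have "card ({..<m} - ?K) \<le> card {0, 1, m - 2, m - 1}" by (intro card_mono) auto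
    also have "\<dots> \<le> 4" by (simp add: card_insert_if)
    finally show "real (card ({..<m} - ?K)) \<le> 4" by simp
  qed (use B0 in auto)
  also have "\<dots> \<le> 8 * B * 2 ^ (d - 1) * real m ^ (d - 1)"
  proof -
    have "1 \<le> real m ^ (d - 1)" using assms(3) by (intro one_le_power) auto
    then have "8 * B * 2 ^ (d - 1) * 1 \<le> 8 * B * 2 ^ (d - 1) * real m ^ (d - 1)" using B0 by (intro mult_left_mono) auto
    moreover have "4 * (2 ^ (d - 1) * (2 * B)) = 8 * B * 2 ^ (d - 1) * 1" by simp
    ultimately show ?thesis by (simp only:)
  qed
  finally have ends: "(\<Sum>k\<in>{..<m} - ?K. \<kappa> k * \<bar>g (x k) - g (y k)\<bar>) \<le> 8 * B * 2 ^ (d - 1) * real m ^ (d - 1)" .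
  have "(\<Sum>k<m. \<kappa> k * \<bar>g (x k) - g (y k)\<bar>) = (\<Sum>k\<in>?K. \<kappa> k * \<bar>g (x k) - g (y k)\<bar>) + (\<Sum>k\<in>{..<m} - ?K. \<kappa> k * \<bar>g (x k) - g (y k)\<bar>)"
    by (rule sum.subset_diff[THEN trans]) (auto simp: add.commute)
  with int ends show ?thesis unfolding \<kappa>_def by (simp add: algebra_simps)
qed

text \<open>Closed at both ends, so that each zone is compact and extrema are attained; neighbouring
  zones overlap in their common edge.\<close>

definition polar_zone :: "'a::euclidean_space \<Rightarrow> nat \<Rightarrow> nat \<Rightarrow> 'a set" where
  "polar_zone e m k = {x. norm x = 1 \<and> arccos (x \<bullet> e) \<in> {real k * (pi / m)..(real k + 1) * (pi / m)}}"

lemma polar_zone_cover: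
  fixes e x :: "'a::euclidean_space"
  assumes "norm e = 1" "norm x = 1" "m \<ge> 1"
  obtains k where "k < m" "x \<in> polar_zone e m k"
proof -
  define \<eta> where "\<eta> = pi / real m"
  have \<eta>: "\<eta> > 0" "real m * \<eta> = pi" using assms(3) by (auto simp: \<eta>_def)
  let ?\<theta> = "arccos (x \<bullet> e)"
  have \<theta>: "0 \<le> ?\<theta>" "?\<theta> \<le> pi" using arccos_inner_unit[OF assms(1,2)] by auto
  show thesis
  \<comment> \<open>At angle \<pi> the floor would give k = m; the last zone contains this pole
    because its upper edge is included.\<close>
  proof (cases "?\<theta> = pi")
    case True
    have "(real (m - 1) + 1) * \<eta> = pi" using \<eta> assms(3) by (simp add: of_nat_diff)
    moreover have "real (m - 1) * \<eta> \<le> real m * \<eta>" using \<eta> by (intro mult_right_mono) auto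
    ultimately have "x \<in> polar_zone e m (m - 1)"
      using True assms(2) \<eta> by (simp add: polar_zone_def \<eta>_def[symmetric])
    then show thesis using that[of "m - 1"] assms(3) by simp
  next
    case False
    define k where "k = nat \<lfloor>?\<theta> / \<eta>\<rfloor>"
    have k: "real k \<le> ?\<theta> / \<eta>" "?\<theta> / \<eta> < real k + 1" using \<theta> \<eta> by (auto simp: k_def)
    then have k': "real k * \<eta> \<le> ?\<theta>" "?\<theta> \<le> (real k + 1) * \<eta>" using \<eta> by (auto simp: field_simps)
    have "real k * \<eta> < real m * \<eta>" using k' False \<theta> \<eta> by linarith
    then have "k < m" using \<eta>(1) by (metis mult_less_cancel_right_pos of_nat_less_iff)
    moreover have "x \<in> polar_zone e m k" using k' assms(2) by (simp add: polar_zone_def \<eta>_def[symmetric])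
    ultimately show thesis by (rule that)
  qed
qed

lemma polar_zone_extrema:
  fixes e :: "'a::euclidean_space" and g :: "'a \<Rightarrow> real"
  assumes "norm e = 1" "DIM('a) \<ge> 2" "k < m" "continuous_on (sphere 0 1) g"
  obtains y z where "y \<in> polar_zone e m k" "z \<in> polar_zone e m k"
    "\<And>x. x \<in> polar_zone e m k \<Longrightarrow> g y \<le> g x \<and> g x \<le> g z"
proof -
  let ?Z = "polar_zone e m k"
  have "?Z = sphere 0 1 \<inter> (\<lambda>x. arccos (x \<bullet> e)) -` {real k * (pi / m)..(real k + 1) * (pi / m)}"
    by (auto simp: polar_zone_def)
  also have "closed \<dots>"
    by (intro continuous_closed_preimage continuous_on_polar_angle assms) auto
  finally have "closed ?Z" .
  moreover have sub: "?Z \<subseteq> sphere 0 1" by (auto simp: polar_zone_def)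
  ultimately have comp: "compact ?Z"
    by (metis Int_absorb2 compact_Int_closed compact_sphere inf_commute)
  obtain w where w: "w \<noteq> 0" "orthogonal e w" using orthogonal_to_vector_exists[OF assms(2)] by blast
  \<comment> \<open>A witness that the zone is nonempty: a point on its lower edge.\<close>
  let ?t = "real k * (pi / m)" and ?\<omega> = "w /\<^sub>R norm w"
  let ?x = "cos ?t *\<^sub>R e + sin ?t *\<^sub>R ?\<omega>"
  have \<omega>: "norm ?\<omega> = 1" "?\<omega> \<bullet> e = 0" using w by (auto simp: orthogonal_def inner_commute)
  have "?x \<bullet> e = cos ?t" using \<omega> assms(1) by (simp add: inner_add_left dot_square_norm)
  moreover have "0 \<le> ?t" "?t \<le> pi"
  proof -
    have "real k * (pi / m) \<le> real m * (pi / m)" using assms(3) by (intro mult_right_mono) auto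
    then show "?t \<le> pi" using assms(3) by simp
  qed simp
  ultimately have "arccos (?x \<bullet> e) = ?t" by (simp add: arccos_cos)
  moreover have "norm ?x = 1"
  proof -
    have "(norm ?x)\<^sup>2 = (norm (cos ?t *\<^sub>R e))\<^sup>2 + (norm (sin ?t *\<^sub>R ?\<omega>))\<^sup>2"
      by (rule norm_add_Pythagorean) (use w in \<open>simp add: orthogonal_def\<close>)
    also have "\<dots> = 1" unfolding norm_scaleR[of _ "w /\<^sub>R norm w"] norm_scaleR[of _ e] \<omega>(1) assms(1) by simp
    finally show ?thesis by (simp add: power2_eq_1_iff) (smt (verit) norm_ge_zero)
  qed
  moreover have "?t \<le> (real k + 1) * (pi / m)" by (intro mult_right_mono) auto
  ultimately have ne: "?x \<in> ?Z"
    unfolding polar_zone_def mem_Collect_eq atLeastAtMost_iff by (metis order_refl)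
  then show thesis
    using that continuous_attains_inf[OF comp _ continuous_on_subset[OF assms(4) sub]]
      continuous_attains_sup[OF comp _ continuous_on_subset[OF assms(4) sub]]
    by (metis empty_iff)
qed

section \<open>Covering the graph\<close>

lemma abs_cos_diff_le: "\<bar>cos a - cos b\<bar> \<le> \<bar>a - b\<bar>" for a b :: real
proof -
  have "norm (cos a - cos b) \<le> 1 * norm (a - b)"
    by (rule field_differentiable_bound[where S = UNIV and f' = "\<lambda>x. - sin x"])
      (auto intro!: derivative_eq_intros)
  then show ?thesis by simp
qed

lemma abs_sin_diff_le: "\<bar>sin a - sin b\<bar> \<le> \<bar>a - b\<bar>" for a b :: real
proof -
  have "norm (sin a - sin b) \<le> 1 * norm (a - b)"
    by (rule field_differentiable_bound[where S = UNIV and f' = cos])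
      (auto intro!: derivative_eq_intros)
  then show ?thesis by simp
qed

text \<open>Three errors of at most \<eta> each: moving the cosine and the sine to the lower edge of
  the zone, and replacing the equatorial direction. The last is at most (\<kappa>
  \<eta>)(1/\<kappa>), because sin \<theta> \<le> \<kappa> \<eta> in the zone.\<close>

lemma polar_zone_near_net:
  fixes e x :: "'a::euclidean_space"
  assumes "norm e = 1" "DIM('a) \<ge> 2" "k < m" "x \<in> polar_zone e m k"
    and net: "\<And>\<omega>. norm \<omega> = 1 \<Longrightarrow> \<omega> \<bullet> e = 0 \<Longrightarrow> \<exists>\<omega>'\<in>P. dist \<omega> \<omega>' \<le> 1 / real (min (k + 1) (m - k))"
    and P: "P \<subseteq> {\<omega>. norm \<omega> = 1 \<and> \<omega> \<bullet> e = 0}"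
  obtains \<omega>' where "\<omega>' \<in> P"
    "dist x (cos (real k * (pi / m)) *\<^sub>R e + sin (real k * (pi / m)) *\<^sub>R \<omega>') \<le> 3 * (pi / m)"
proof -
  define \<eta> where "\<eta> = pi / real m"
  have \<eta>: "\<eta> > 0" "real m * \<eta> = pi" using assms(3) by (auto simp: \<eta>_def)
  let ?\<theta> = "arccos (x \<bullet> e)" and ?t = "real k * \<eta>" and ?\<kappa> = "real (min (k + 1) (m - k))"
  have x: "norm x = 1" "?t \<le> ?\<theta>" "?\<theta> \<le> (real k + 1) * \<eta>"
    using assms(4) by (auto simp: polar_zone_def \<eta>_def)
  have \<theta>: "0 \<le> ?\<theta>" "?\<theta> \<le> pi" using arccos_inner_unit[OF assms(1) x(1)] by auto
  have \<kappa>: "?\<kappa> > 0" using assms(3) by simp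
  obtain \<omega> where \<omega>: "norm \<omega> = 1" "\<omega> \<bullet> e = 0" "x = cos ?\<theta> *\<^sub>R e + sin ?\<theta> *\<^sub>R \<omega>"
    using polar_decomposition[OF assms(1,2) x(1)] by blast
  obtain \<omega>' where \<omega>': "\<omega>' \<in> P" "dist \<omega> \<omega>' \<le> 1 / ?\<kappa>" using net[OF \<omega>(1,2)] by blast
  have n': "norm \<omega>' = 1" using \<omega>'(1) P by auto
  have sin: "0 \<le> sin ?\<theta>" "sin ?\<theta> \<le> ?\<kappa> * \<eta>"
  proof -
    show "0 \<le> sin ?\<theta>" using \<theta> by (simp add: sin_ge_zero)
    have "sin ?\<theta> \<le> ?\<theta>" using \<theta> by (intro sin_x_le_x)
    moreover have "sin ?\<theta> \<le> pi - ?\<theta>" using sin_x_le_x[of "pi - ?\<theta>"] \<theta> by simp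
    moreover have "pi - ?t = real (m - k) * \<eta>" using \<eta> assms(3) by (simp add: of_nat_diff left_diff_distrib)
    moreover have "(real k + 1) * \<eta> = real (k + 1) * \<eta>" by (simp add: algebra_simps)
    ultimately have "sin ?\<theta> \<le> real (k + 1) * \<eta>" "sin ?\<theta> \<le> real (m - k) * \<eta>"
      using x by linarith+
    then show "sin ?\<theta> \<le> ?\<kappa> * \<eta>" by (auto simp only: min_def split: if_split)
  qed
  have td: "\<bar>?\<theta> - ?t\<bar> \<le> \<eta>" using x by (simp add: algebra_simps)
  have "x - (cos ?t *\<^sub>R e + sin ?t *\<^sub>R \<omega>') =
     (cos ?\<theta> - cos ?t) *\<^sub>R e + ((sin ?\<theta> - sin ?t) *\<^sub>R \<omega>' + sin ?\<theta> *\<^sub>R (\<omega> - \<omega>'))"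
    by (subst \<omega>(3)) (simp add: algebra_simps)
  then have "dist x (cos ?t *\<^sub>R e + sin ?t *\<^sub>R \<omega>') \<le>
     norm ((cos ?\<theta> - cos ?t) *\<^sub>R e) + (norm ((sin ?\<theta> - sin ?t) *\<^sub>R \<omega>') + norm (sin ?\<theta> *\<^sub>R (\<omega> - \<omega>')))"
    unfolding dist_norm by (metis norm_triangle_mono norm_triangle_ineq order_refl)
  also have "\<dots> \<le> \<eta> + (\<eta> + \<eta>)"
  proof (intro add_mono)
    show "norm ((cos ?\<theta> - cos ?t) *\<^sub>R e) \<le> \<eta>" using abs_cos_diff_le[of ?\<theta> ?t] td assms(1) by simp
    show "norm ((sin ?\<theta> - sin ?t) *\<^sub>R \<omega>') \<le> \<eta>" using abs_sin_diff_le[of ?\<theta> ?t] td n' by simp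
    have "sin ?\<theta> * dist \<omega> \<omega>' \<le> (?\<kappa> * \<eta>) * (1 / ?\<kappa>)" using sin \<omega>'(2) \<eta> by (intro mult_mono) auto
    also have "\<dots> = \<eta>" using \<kappa> by simp
    finally show "norm (sin ?\<theta> *\<^sub>R (\<omega> - \<omega>')) \<le> \<eta>" using sin(1) by (simp add: dist_norm)
  qed
  finally show thesis using that[OF \<omega>'(1)] by (simp add: \<eta>_def)
qed

lemma sphere_graph_cover:
  fixes e :: "'a::euclidean_space" and g :: "'a \<Rightarrow> real"
  assumes e: "norm e = 1" "DIM('a) = d + 1" "d \<ge> 1"
    and cont: "continuous_on (sphere 0 1) g"
    and lim: "AE x in surface_measure. (\<lambda>j. poly (Q j) (x \<bullet> e)) \<longlonglongrightarrow> g x"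
    and V: "\<And>j. integral {0..pi} (\<lambda>\<theta>. \<bar>poly (pderiv (Q j)) (cos \<theta>)\<bar> * sin \<theta> ^ d) \<le> V"
  shows "\<exists>K>0. \<forall>\<epsilon>. 0 < \<epsilon> \<and> \<epsilon> \<le> 1 \<longrightarrow> real (box_covering_number (sphere_graph g) \<epsilon>) \<le> K * (1 / \<epsilon>) ^ d"
proof -
  have dim2: "DIM('a) \<ge> 2" using e by simp
  have "bounded (g ` sphere 0 1)"
    by (intro compact_imp_bounded compact_continuous_image cont compact_sphere)
  then obtain B where "\<forall>y\<in>g ` sphere 0 1. norm y \<le> B" unfolding bounded_iff by blast
  then have B: "\<And>x. norm x = 1 \<Longrightarrow> \<bar>g x\<bar> \<le> B" by auto
  have B0: "B \<ge> 0" using B[of e] e(1) by linarith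
  define C where "C = 5 ^ (d - 1) * (3 * V) + 1 + 8 * B * 2 ^ (d - 1)"
  have V0: "0 \<le> V"
  proof -
    have "0 \<le> integral {0..pi} (\<lambda>\<theta>. \<bar>poly (pderiv (Q 0)) (cos \<theta>)\<bar> * sin \<theta> ^ d)"
      by (intro integral_nonneg integrable_continuous_real continuous_intros continuous_on_poly)
        (auto simp: sin_ge_zero)
    with V[of 0] show ?thesis by linarith
  qed
  have C: "C > 0" unfolding C_def using V0 B0 by (simp add: add_nonneg_pos add_pos_nonneg)
  define K where "K = 9 ^ (d + 1) * (25 ^ d + C * 25 ^ (d - 1))"
  have "K > 0" unfolding K_def using C by (intro mult_pos_pos add_pos_nonneg) auto
  moreover have "real (box_covering_number (sphere_graph g) \<epsilon>) \<le> K * (1 / \<epsilon>) ^ d" if \<epsilon>: "0 < \<epsilon>" "\<epsilon> \<le> 1" for \<epsilon>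
  proof -
    \<comment> \<open>The horizontal error 3 \<pi> / m has to be at most \<epsilon>/2, so m \<ge> 6
      \<pi> / \<epsilon>, and 6 \<pi> < 24. Rounding up costs at most 1 \<le> 1/\<epsilon>, whence
      the 25 in \<open>K\<close>.\<close>
    define m where "m = nat \<lceil>24 / \<epsilon>\<rceil>"
    have m: "24 / \<epsilon> \<le> real m" "real m \<le> 25 / \<epsilon>"
    proof -
      have r: "real m = of_int \<lceil>24 / \<epsilon>\<rceil>" using \<epsilon> by (simp add: m_def)
      show "24 / \<epsilon> \<le> real m" unfolding r by (rule le_of_int_ceiling)
      have "real m < 24 / \<epsilon> + 1" unfolding r using ceiling_correct[of "24 / \<epsilon>"] by linarith
      also have "\<dots> \<le> 25 / \<epsilon>" using \<epsilon> by (simp add: field_simps)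
      finally show "real m \<le> 25 / \<epsilon>" by simp
    qed
    have "0 < 24 / \<epsilon>" using \<epsilon> by simp
    then have m0: "m \<ge> 1" using m(1) by (metis One_nat_def Suc_leI le_less_trans not_le of_nat_0_less_iff order.strict_trans2)
    have mesh: "3 * (pi / real m) \<le> \<epsilon> / 2"
    proof -
      have "24 \<le> \<epsilon> * real m" using m(1) \<epsilon> by (simp add: field_simps)
      then have "6 * pi \<le> \<epsilon> * real m" using pi_less_4 by linarith
      then show ?thesis using m0 by (simp add: field_simps)
    qed
    define \<kappa> where "\<kappa> k = real (min (k + 1) (m - k))" for k
    have "\<exists>y z. y \<in> polar_zone e m k \<and> z \<in> polar_zone e m k \<and>
        (\<forall>x\<in>polar_zone e m k. g y \<le> g x \<and> g x \<le> g z)" if "k < m" for k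
      using polar_zone_extrema[OF e(1) dim2 that cont] by metis
    then obtain y z where yz: "\<And>k. k < m \<Longrightarrow> y k \<in> polar_zone e m k \<and> z k \<in> polar_zone e m k \<and>
        (\<forall>x\<in>polar_zone e m k. g (y k) \<le> g x \<and> g x \<le> g (z k))" by metis
    then have yz': "\<And>k. k < m \<Longrightarrow> y k \<in> polar_zone e m k \<and> z k \<in> polar_zone e m k" by blast
    define osc where "osc k = \<bar>g (z k) - g (y k)\<bar>" for k
    have sum_osc: "(\<Sum>k<m. \<kappa> k ^ (d - 1) * osc k) \<le> C * real m ^ (d - 1)"
      unfolding \<kappa>_def osc_def C_def
      by (rule sum_oscillation_le[OF e(1,3) m0 cont B lim V])
        (use yz' in \<open>simp_all add: polar_zone_def\<close>)
    define net where "net k P \<longleftrightarrow> finite P \<and> P \<subseteq> {\<omega>. norm \<omega> = 1 \<and> \<omega> \<bullet> e = 0} \<and>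
        real (card P) \<le> 9 ^ (d + 1) * \<kappa> k ^ (d - 1) \<and>
        (\<forall>\<omega>. norm \<omega> = 1 \<longrightarrow> \<omega> \<bullet> e = 0 \<longrightarrow> (\<exists>\<omega>'\<in>P. dist \<omega> \<omega>' \<le> 1 / \<kappa> k))" for k P
    have "\<exists>P. net k P" if "k < m" for k
    proof -
      have "\<kappa> k \<ge> 1" using that by (simp add: \<kappa>_def)
      then have "0 < 1 / \<kappa> k" "1 / \<kappa> k \<le> 1" by auto
      from equator_net[OF e(1) dim2 this] obtain P where
        "finite P" "P \<subseteq> {\<omega>. norm \<omega> = 1 \<and> \<omega> \<bullet> e = 0}"
        "real (card P) \<le> 9 ^ DIM('a) * (1 / (1 / \<kappa> k)) ^ (DIM('a) - 2)"
        "\<And>\<omega>. norm \<omega> = 1 \<Longrightarrow> \<omega> \<bullet> e = 0 \<Longrightarrow> \<exists>\<omega>'\<in>P. dist \<omega> \<omega>' \<le> 1 / \<kappa> k" by blast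
      then show ?thesis unfolding net_def using e(2) by (intro exI[of _ P]) simp
    qed
    then obtain P where "\<And>k. k < m \<Longrightarrow> net k (P k)" by metis
    then have P: "finite (P k)" "P k \<subseteq> {\<omega>. norm \<omega> = 1 \<and> \<omega> \<bullet> e = 0}"
        "real (card (P k)) \<le> 9 ^ (d + 1) * \<kappa> k ^ (d - 1)"
        "\<And>\<omega>. norm \<omega> = 1 \<Longrightarrow> \<omega> \<bullet> e = 0 \<Longrightarrow> \<exists>\<omega>'\<in>P k. dist \<omega> \<omega>' \<le> 1 / \<kappa> k" if "k < m" for k
      using that unfolding net_def by blast+
    \<comment> \<open>Number of stacked boxes over one net point: starting at the minimum
      \<open>g (y k)\<close>, they reach the maximum over the zone.\<close>
    define n where "n k = nat \<lfloor>osc k / \<epsilon>\<rfloor> + 1" for k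
    \<comment> \<open>Boxes are given by their lowest corner, so the spherical part is shifted by
      \<epsilon>/2 in each coordinate to centre the box at the net point.\<close>
    define corner where "corner k w = (case w of (\<omega>, i) \<Rightarrow>
        (cos (real k * (pi / m)) *\<^sub>R e + sin (real k * (pi / m)) *\<^sub>R \<omega> - (\<epsilon> / 2) *\<^sub>R One, g (y k) + real i * \<epsilon>))"
      for k and w :: "'a \<times> nat"
    define A where "A = (\<Union>k<m. corner k ` (P k \<times> {..<n k}))"
    have finA: "finite A" unfolding A_def using P(1) by auto
    have cover: "sphere_graph g \<subseteq> (\<Union>a\<in>A. cbox a (a + \<epsilon> *\<^sub>R One))"
    proof
      fix p assume "p \<in> sphere_graph g"
      then obtain x where x: "norm x = 1" "p = (x, g x)" by (auto simp: sphere_graph_def)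
      obtain k where k: "k < m" "x \<in> polar_zone e m k" using polar_zone_cover[OF e(1) x(1) m0] .
      obtain \<omega>' where \<omega>': "\<omega>' \<in> P k"
        "dist x (cos (real k * (pi / m)) *\<^sub>R e + sin (real k * (pi / m)) *\<^sub>R \<omega>') \<le> 3 * (pi / m)"
        by (rule polar_zone_near_net[OF e(1) dim2 k, of "P k"]) (use P(2,4)[OF k(1)] in \<open>simp_all add: \<kappa>_def\<close>)
      define c where "c = cos (real k * (pi / m)) *\<^sub>R e + sin (real k * (pi / m)) *\<^sub>R \<omega>'"
      define i where "i = nat \<lfloor>(g x - g (y k)) / \<epsilon>\<rfloor>"
      have gx: "0 \<le> g x - g (y k)" "g x - g (y k) \<le> osc k" using yz[OF k(1)] k(2) by (auto simp: osc_def)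
      have i: "real i \<le> (g x - g (y k)) / \<epsilon>" "(g x - g (y k)) / \<epsilon> < real i + 1"
        using gx(1) \<epsilon> by (auto simp: i_def)
      have "i < n k" unfolding i_def n_def
        using gx \<epsilon> by (intro le_imp_less_Suc[unfolded Suc_eq_plus1] nat_mono floor_mono divide_right_mono) auto
      then have "corner k (\<omega>', i) \<in> A" using \<omega>'(1) k(1) by (auto simp: A_def)
      moreover have "p \<in> cbox (corner k (\<omega>', i)) (corner k (\<omega>', i) + \<epsilon> *\<^sub>R One)"
      proof -
        have near: "\<bar>x \<bullet> b - c \<bullet> b\<bar> \<le> \<epsilon> / 2" if "b \<in> Basis" for b
          using Basis_le_norm[OF that, of "x - c"] \<omega>'(2)[folded c_def] mesh by (simp add: inner_diff_left dist_norm)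
        have One: "(One :: 'a \<times> real) = (One, 1)"
          by (simp add: sum_Basis_prod_eq prod_eq_iff fst_sum snd_sum)
        have "x \<in> cbox (c - (\<epsilon> / 2) *\<^sub>R One) (c - (\<epsilon> / 2) *\<^sub>R One + \<epsilon> *\<^sub>R One)"
          unfolding mem_box
        proof
          fix b :: 'a assume b: "b \<in> Basis"
          have "(\<Sum>Basis) \<bullet> b = 1" using b by simp
          then show "(c - (\<epsilon> / 2) *\<^sub>R One) \<bullet> b \<le> x \<bullet> b \<and> x \<bullet> b \<le> (c - (\<epsilon> / 2) *\<^sub>R One + \<epsilon> *\<^sub>R One) \<bullet> b"
            using near[OF b] unfolding abs_le_iff by (simp add: inner_diff_left inner_add_left field_simps)
        qed
        moreover have "g x \<in> cbox (g (y k) + real i * \<epsilon>) (g (y k) + real i * \<epsilon> + \<epsilon>)"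
          using i \<epsilon> by (simp add: field_simps)
        ultimately show ?thesis
          unfolding x(2) corner_def One prod.case c_def[symmetric] by (simp add: cbox_Pair_eq)
      qed
      ultimately show "p \<in> (\<Union>a\<in>A. cbox a (a + \<epsilon> *\<^sub>R One))" by blast
    qed
    have "box_covering_number (sphere_graph g) \<epsilon> \<le> card A"
      unfolding box_covering_number_def by (rule Least_le) (use finA cover in blast)
    also have "card A \<le> (\<Sum>k<m. card (corner k ` (P k \<times> {..<n k})))"
      unfolding A_def by (rule card_UN_le) simp
    also have "\<dots> \<le> (\<Sum>k<m. card (P k) * n k)"
    proof (rule sum_mono)
      fix k assume "k \<in> {..<m}"
      then have "card (corner k ` (P k \<times> {..<n k})) \<le> card (P k \<times> {..<n k})"
        using P(1) by (intro card_image_le) auto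
      then show "card (corner k ` (P k \<times> {..<n k})) \<le> card (P k) * n k" by (simp add: card_cartesian_product)
    qed
    finally have "real (box_covering_number (sphere_graph g) \<epsilon>) \<le> real (\<Sum>k<m. card (P k) * n k)"
      by (simp only: of_nat_le_iff)
    also have "\<dots> = (\<Sum>k<m. real (card (P k)) * real (n k))" by simp
    \<comment> \<open>The one box needed without any oscillation is counted with the crude \<kappa>
      \<le> m, which sums to the m^d of a cover of the sphere itself. The exact weight is kept where
      it multiplies the oscillation.\<close>
    also have "\<dots> \<le> (\<Sum>k<m. 9 ^ (d + 1) * (real m ^ (d - 1) + (\<kappa> k ^ (d - 1) * osc k) / \<epsilon>))"
    proof (rule sum_mono)
      fix k assume "k \<in> {..<m}"
      then have k: "k < m" by simp
      have o: "osc k \<ge> 0" by (simp add: osc_def)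
      have "real (n k) \<le> osc k / \<epsilon> + 1" unfolding n_def using o \<epsilon> by (simp add: of_nat_nat)
      then have "real (card (P k)) * real (n k) \<le> (9 ^ (d + 1) * \<kappa> k ^ (d - 1)) * (osc k / \<epsilon> + 1)"
        using P(3)[OF k] by (intro mult_mono) (auto simp: \<kappa>_def)
      also have "\<dots> = 9 ^ (d + 1) * (\<kappa> k ^ (d - 1) + (\<kappa> k ^ (d - 1) * osc k) / \<epsilon>)"
        by (simp add: algebra_simps)
      also have "\<dots> \<le> 9 ^ (d + 1) * (real m ^ (d - 1) + (\<kappa> k ^ (d - 1) * osc k) / \<epsilon>)"
        using k by (intro mult_left_mono add_right_mono power_mono) (auto simp: \<kappa>_def)
      finally show "real (card (P k)) * real (n k) \<le> 9 ^ (d + 1) * (real m ^ (d - 1) + (\<kappa> k ^ (d - 1) * osc k) / \<epsilon>)" .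
    qed
    also have "\<dots> = 9 ^ (d + 1) * (real m * real m ^ (d - 1) + (\<Sum>k<m. \<kappa> k ^ (d - 1) * osc k) / \<epsilon>)"
      by (simp add: sum_distrib_left[symmetric] sum.distrib sum_divide_distrib[symmetric])
    also have "\<dots> \<le> 9 ^ (d + 1) * ((25 / \<epsilon>) ^ d + C * (25 / \<epsilon>) ^ (d - 1) / \<epsilon>)"
    proof (intro mult_left_mono add_mono divide_right_mono)
      have "real m * real m ^ (d - 1) = real m ^ d" using e(3) by (cases d) auto
      then show "real m * real m ^ (d - 1) \<le> (25 / \<epsilon>) ^ d" using power_mono[OF m(2), of d] by simp
      have "C * real m ^ (d - 1) \<le> C * (25 / \<epsilon>) ^ (d - 1)"
        using C m(2) by (intro mult_left_mono power_mono) auto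
      then show "(\<Sum>k<m. \<kappa> k ^ (d - 1) * osc k) \<le> C * (25 / \<epsilon>) ^ (d - 1)" using sum_osc by linarith
    qed (use \<epsilon> in auto)
    also have "\<dots> = K * (1 / \<epsilon>) ^ d"
    proof -
      obtain j where "d = Suc j" using e(3) by (cases d) auto
      then show ?thesis using \<epsilon> by (simp add: K_def power_divide field_simps)
    qed
    finally show ?thesis .
  qed
  ultimately show ?thesis by blast
qed

text \<open>The gap between \<open>d\<close> and \<open>D\<close> absorbs the constant: as soon as
  ln (1/\<epsilon>) \<ge> |ln K| / (D - d), the quotient is at most \<open>D\<close>.\<close>

lemma fractal_dim_le:
  assumes "K > 0" and N: "\<And>\<epsilon>. 0 < \<epsilon> \<Longrightarrow> \<epsilon> \<le> 1 \<Longrightarrow> real (box_covering_number E \<epsilon>) \<le> K * (1 / \<epsilon>) ^ d"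
    and D: "real d < D"
  shows "fractal_dim E \<le> ereal D"
proof -
  have "filterlim (\<lambda>\<epsilon>::real. ln (1 / \<epsilon>)) at_top (at_right 0)"
  proof -
    have "filterlim (\<lambda>\<epsilon>::real. - ln \<epsilon>) at_top (at_right 0)"
      using ln_at_0 by (simp add: filterlim_uminus_at_top)
    then show ?thesis
      by (rule filterlim_mono_eventually) (auto simp: eventually_at_right_less ln_div eventually_at_filter intro!: always_eventually)
  qed
  then have "\<forall>\<^sub>F \<epsilon> in at_right 0. max 1 (\<bar>ln K\<bar> / (D - real d)) \<le> ln (1 / \<epsilon> :: real)"
    unfolding filterlim_at_top by (rule spec)
  moreover have "\<forall>\<^sub>F \<epsilon> in at_right (0::real). 0 < \<epsilon>" by (rule eventually_at_right_less)
  moreover have "\<forall>\<^sub>F \<epsilon> in at_right (0::real). \<epsilon> < 1"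
    by (rule eventually_at_right_real[THEN eventually_mono]) auto
  ultimately have "\<forall>\<^sub>F \<epsilon> in at_right 0. ereal (ln (real (box_covering_number E \<epsilon>)) / ln (1 / \<epsilon>)) \<le> ereal D"
  proof eventually_elim
    case (elim \<epsilon>)
    let ?N = "real (box_covering_number E \<epsilon>)" and ?L = "ln (1 / \<epsilon>)"
    have L: "?L \<ge> 1" "\<bar>ln K\<bar> \<le> (D - real d) * ?L"
      using elim(1) D by (auto simp: pos_divide_le_eq mult.commute)
    have "ln ?N \<le> D * ?L"
    proof (cases "box_covering_number E \<epsilon> = 0")
      \<comment> \<open>Here \<open>ln 0 = 0\<close> by convention, and \<open>D\<close> is
        positive.\<close>
      case True
      have "0 \<le> D * ?L" using D L by (intro mult_nonneg_nonneg) auto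
      then show ?thesis using True by simp
    next
      case False
      have "ln ?N \<le> ln (K * (1 / \<epsilon>) ^ d)"
        using N[of \<epsilon>] elim(2,3) False by (intro ln_mono) auto
      also have "\<dots> = ln K + real d * ?L"
        using assms(1) elim(2) by (subst ln_mult) (auto simp: ln_realpow)
      also have "\<dots> \<le> D * ?L" using L(2) by (simp add: left_diff_distrib)
      finally show ?thesis .
    qed
    then show ?case using L(1) by (simp add: pos_divide_le_eq)
  qed
  then show ?thesis unfolding fractal_dim_def by (rule Limsup_bounded)
qed

section \<open>Zonal Sobolev functions\<close>

text \<open>On a null sphere even \<open>False\<close> would hold almost everywhere, against the
  density of sets of full measure.\<close>

lemma sphere_area_nonzero:
  assumes "norm (e :: 'a::euclidean_space) = 1"
  shows "sphere_area TYPE('a) \<noteq> 0"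
proof
  assume 0: "sphere_area TYPE('a) = 0"
  interpret finite_measure "surface_measure :: 'a measure" by (rule finite_measure_surface_measure)
  have "emeasure (surface_measure :: 'a measure) (space surface_measure) = 0"
    using 0 by (simp add: sphere_area_def emeasure_eq_measure)
  then have "space surface_measure \<in> null_sets (surface_measure :: 'a measure)"
    by (rule null_setsI) (rule sets.top)
  then have "AE x in (surface_measure :: 'a measure). False"
    by (rule AE_I') auto
  then show False using AE_surface_measure_dense[of "\<lambda>_. False" e 1] assms by simp
qed

text \<open>\<open>Re\<close> and \<open>Im\<close> are treated at once as real-linear maps that do
  not increase the modulus; such a map turns complex partial sums into real polynomials in
  \<open>x \<bullet> e\<close> with smaller coefficients and the same convergence.\<close>

lemma fractal_dim_sphere_graph_le:
  fixes e :: "'a::euclidean_space" and w :: "'a \<Rightarrow> complex" and part :: "complex \<Rightarrow> real"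
  assumes e: "norm e = 1" "DIM('a) = d + 1" "d \<ge> 1" and "1 \<le> s"
    and w: "w \<in> zonal_sobolev e s" "continuous_on (sphere 0 1) w"
    and part: "part = Re \<or> part = Im" and D: "real d < D"
  shows "fractal_dim (sphere_graph (\<lambda>x. part (w x))) \<le> ereal D"
proof -
  let ?\<mu> = "surface_measure :: 'a measure"
  interpret finite_measure ?\<mu> by (rule finite_measure_surface_measure)
  have part_diff: "part (z - z') = part z - part z'" and part_sum: "part (sum h I) = (\<Sum>i\<in>I. part (h i))"
    and part_mult: "part (z * of_real r) = part z * r" and part_le: "\<bar>part z\<bar> \<le> cmod z"
    for z z' r and h :: "nat \<Rightarrow> complex" and I
    using part by (auto simp: abs_Re_le_cmod abs_Im_le_cmod)
  obtain b where b: "zonal_expansion e b w" "summable (\<lambda>n. (1 + (real n)\<^sup>2) powr s * (cmod (b n))\<^sup>2)"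
    using w(1) by (auto simp: zonal_sobolev_def)
  define S where "S N = (\<Sum>n\<le>N. smult (part (b n)) (zonal_poly d n))" for N
  define T where "T N x = (\<Sum>n\<le>N. b n * of_real (zonal_harmonic e n x))" for N x
  have Y: "zonal_harmonic e n x = poly (zonal_poly d n) (x \<bullet> e)" for n x
    by (rule zonal_harmonic_eq_poly[OF e(2,3,1) sphere_area_nonzero[OF e(1)]])
  have partT: "part (T N x) = poly (S N) (x \<bullet> e)" for N x
    by (simp add: T_def S_def part_sum part_mult poly_sum Y)
  have w_meas: "w \<in> borel_measurable ?\<mu>" and w_int: "integrable ?\<mu> (\<lambda>x. (cmod (w x))\<^sup>2)"
    and w_lim: "(\<lambda>N. \<integral>x. (cmod (w x - T N x))\<^sup>2 \<partial>?\<mu>) \<longlonglongrightarrow> 0"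
    using b(1) by (auto simp: zonal_expansion_def sphere_L2_def T_def)
  have Tc: "continuous_on UNIV (T N)" for N
    unfolding T_def Y by (intro continuous_intros continuous_on_poly)
  then have T_meas: "T N \<in> borel_measurable ?\<mu>" for N
    by (intro borel_measurable_surface_measure borel_measurable_continuous_onI)
  have int: "integrable ?\<mu> (\<lambda>x. (cmod (w x - T N x))\<^sup>2)" for N
  proof -
    have "bounded (T N ` sphere 0 1)"
      by (intro compact_imp_bounded compact_continuous_image continuous_on_subset[OF Tc] compact_sphere) auto
    then obtain B where B: "\<forall>y\<in>T N ` sphere 0 1. norm y \<le> B" unfolding bounded_iff by blast
    \<comment> \<open>The partial sums are bounded on the compact sphere and the measure is finite,
      so (a + b)^2 \<le> 2 a^2 + 2 b^2 provides an integrable majorant.\<close>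
    have "integrable ?\<mu> (\<lambda>x. 2 * (cmod (w x))\<^sup>2 + 2 * B\<^sup>2)" using w_int by simp
    then show ?thesis
    proof (rule Bochner_Integration.integrable_bound)
      show "(\<lambda>x. (cmod (w x - T N x))\<^sup>2) \<in> borel_measurable ?\<mu>" using w_meas T_meas by simp
      show "AE x in ?\<mu>. norm ((cmod (w x - T N x))\<^sup>2) \<le> norm (2 * (cmod (w x))\<^sup>2 + 2 * B\<^sup>2)"
      proof (rule AE_I2)
        fix x :: 'a assume "x \<in> space ?\<mu>"
        then have "cmod (T N x) \<le> B" using B by auto
        then have "cmod (w x - T N x) \<le> cmod (w x) + B" by (meson add_left_mono norm_triangle_ineq4 order_trans)
        then have "(cmod (w x - T N x))\<^sup>2 \<le> (cmod (w x) + B)\<^sup>2" by (intro power_mono) auto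
        also have "\<dots> \<le> 2 * (cmod (w x))\<^sup>2 + 2 * B\<^sup>2"
          using sum_squares_bound[of "cmod (w x)" B] by (simp add: power2_sum)
        finally show "norm ((cmod (w x - T N x))\<^sup>2) \<le> norm (2 * (cmod (w x))\<^sup>2 + 2 * B\<^sup>2)" by simp
      qed
    qed
  qed
  \<comment> \<open>Convergence in L^2 is L^1 convergence of the squared error, which converges
    almost everywhere along a subsequence.\<close>
  have "\<exists>r::nat\<Rightarrow>nat. strict_mono r \<and> (AE x in ?\<mu>. (\<lambda>n. (cmod (w x - T (r n) x))\<^sup>2) \<longlonglongrightarrow> 0)"
    by (rule tendsto_L1_AE_subseq[OF int]) (use w_lim in simp)
  then obtain r where r: "AE x in ?\<mu>. (\<lambda>n. (cmod (w x - T (r n) x))\<^sup>2) \<longlonglongrightarrow> 0" by blast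
  have lim: "AE x in ?\<mu>. (\<lambda>j. poly (S (r j)) (x \<bullet> e)) \<longlonglongrightarrow> part (w x)"
    using r
  proof eventually_elim
    case (elim x)
    then have "(\<lambda>n. cmod (w x - T (r n) x)) \<longlonglongrightarrow> 0" using tendsto_real_sqrt[OF elim] by simp
    then have "(\<lambda>n. part (w x - T (r n) x)) \<longlonglongrightarrow> 0"
      by (rule Lim_null_comparison[rotated]) (simp add: part_le)
    then have "(\<lambda>n. part (w x) - (part (w x) - part (T (r n) x))) \<longlonglongrightarrow> part (w x) - 0"
      unfolding part_diff by (intro tendsto_diff tendsto_const)
    then show ?case by (simp add: partT)
  qed
  let ?I = "zonal_integral d"
  define M where "M = real d * (\<Sum>n. (1 + (real n)\<^sup>2) powr s * (cmod (b n))\<^sup>2)"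
  have energy: "?I ([:1, 0, -1:] * pderiv (S N) * pderiv (S N)) \<le> ?I 1 * M" for N
  proof -
    have "?I ([:1, 0, -1:] * pderiv (S N) * pderiv (S N)) \<le> ?I 1 * (\<Sum>n\<le>N. real d * (real n)\<^sup>2 * (part (b n))\<^sup>2)"
      unfolding S_def by (rule zonal_integral_energy[OF e(3)])
    also have "(\<Sum>n\<le>N. real d * (real n)\<^sup>2 * (part (b n))\<^sup>2) \<le> (\<Sum>n\<le>N. real d * ((1 + (real n)\<^sup>2) powr s * (cmod (b n))\<^sup>2))"
    proof (rule sum_mono)
      fix n
      \<comment> \<open>The condition s \<ge> 1 enters here: the energy weighs coefficients by n^2,
        the H^1 weight, so \<open>M\<close> bounds all partial sums uniformly.\<close>
      have "(real n)\<^sup>2 \<le> (1 + (real n)\<^sup>2) powr 1" by (simp add: add_nonneg_nonneg)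
      also have "\<dots> \<le> (1 + (real n)\<^sup>2) powr s" using assms(4) by (intro powr_mono) auto
      finally have "(real n)\<^sup>2 * (part (b n))\<^sup>2 \<le> (1 + (real n)\<^sup>2) powr s * (cmod (b n))\<^sup>2"
        using power_mono[OF part_le[of "b n"], of 2] by (intro mult_mono) auto
      then show "real d * (real n)\<^sup>2 * (part (b n))\<^sup>2 \<le> real d * ((1 + (real n)\<^sup>2) powr s * (cmod (b n))\<^sup>2)"
        unfolding mult.assoc by (intro mult_left_mono) auto
    qed
    also have "\<dots> \<le> M"
      unfolding M_def sum_distrib_left[symmetric] by (intro mult_left_mono sum_le_suminf b(2)) auto
    finally show ?thesis using zonal_integral_1_pos[of d] by (simp add: mult_left_mono)
  qed
  have V: "integral {0..pi} (\<lambda>\<theta>. \<bar>poly (pderiv (S (r j))) (cos \<theta>)\<bar> * sin \<theta> ^ d) \<le> (?I 1 + ?I 1 * M) / 2" for j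
    by (rule order_trans[OF integral_abs_deriv_le_energy[OF e(3)] divide_right_mono[OF add_left_mono[OF energy]]]) simp
  have "continuous_on (sphere 0 1) (\<lambda>x. part (w x))"
    using part w(2) by (auto intro!: continuous_intros)
  from sphere_graph_cover[OF e this lim V]
  obtain K where "K > 0" "\<And>\<epsilon>. 0 < \<epsilon> \<Longrightarrow> \<epsilon> \<le> 1 \<Longrightarrow>
      real (box_covering_number (sphere_graph (\<lambda>x. part (w x))) \<epsilon>) \<le> K * (1 / \<epsilon>) ^ d" by blast
  then show ?thesis by (rule fractal_dim_le) (use D in auto)
qed

section \<open>Regularity of the data, and conclusion\<close>

text \<open>The general term is at most a constant times n^(2s - 2p), and for s = p - 1/2 -
  \<epsilon> this exponent is -1 - 2 \<epsilon>.\<close>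

lemma zonal_sobolev_of_decay:
  assumes "zonal_expansion e a f" "0 < \<epsilon>"
    and a: "\<And>n. n \<ge> 1 \<Longrightarrow> cmod (a n) \<le> C / real n powr p"
  shows "f \<in> zonal_sobolev e (p - 1 / 2 - \<epsilon>)"
proof -
  define s where "s = p - 1 / 2 - \<epsilon>"
  have "summable (\<lambda>n. (1 + (real n)\<^sup>2) powr s * (cmod (a n))\<^sup>2)"
  proof (rule summable_comparison_test')
    show "summable (\<lambda>n. (2 powr \<bar>s\<bar> * C\<^sup>2) * real n powr (2 * s - 2 * p))"
      using assms(2) by (intro summable_mult) (simp add: summable_real_powr_iff s_def)
    fix n :: nat assume n: "n \<ge> 1"
    have n2: "1 \<le> (real n)\<^sup>2" using n by simp
    \<comment> \<open>1 + n^2 lies between n^2 and 2 n^2. The sign of \<open>s\<close> decides which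
      end bounds the power, and the factor 2 powr |s| covers both.\<close>
    have "(1 + (real n)\<^sup>2) powr s \<le> 2 powr \<bar>s\<bar> * real n powr (2 * s)"
    proof (cases "s \<ge> 0")
      case True
      have "(1 + (real n)\<^sup>2) powr s \<le> (2 * (real n)\<^sup>2) powr s"
        using True n2 by (intro powr_mono2) auto
      then show ?thesis using True n by (simp add: powr_mult powr_powr flip: powr_numeral)
    next
      case False
      have "(1 + (real n)\<^sup>2) powr s \<le> ((real n)\<^sup>2) powr s"
        using False n2 by (intro powr_mono2') auto
      also have "\<dots> = 1 * real n powr (2 * s)" using n by (simp add: powr_powr flip: powr_numeral)
      also have "\<dots> \<le> 2 powr \<bar>s\<bar> * real n powr (2 * s)"
        by (intro mult_right_mono) (auto simp: ge_one_powr_ge_zero)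
      finally show ?thesis .
    qed
    moreover have "(cmod (a n))\<^sup>2 \<le> C\<^sup>2 * real n powr (- 2 * p)"
    proof -
      have "(cmod (a n))\<^sup>2 \<le> (C / real n powr p)\<^sup>2" by (intro power_mono a n) auto
      also have "\<dots> = C\<^sup>2 * real n powr (- 2 * p)"
        using n by (simp add: power_divide powr_minus field_simps powr_power)
      finally show ?thesis .
    qed
    ultimately have "(1 + (real n)\<^sup>2) powr s * (cmod (a n))\<^sup>2 \<le>
        (2 powr \<bar>s\<bar> * real n powr (2 * s)) * (C\<^sup>2 * real n powr (- 2 * p))"
      by (intro mult_mono) auto
    also have "\<dots> = (2 powr \<bar>s\<bar> * C\<^sup>2) * real n powr (2 * s - 2 * p)"
      using n by (simp add: powr_diff powr_minus divide_inverse)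
    finally show "norm ((1 + (real n)\<^sup>2) powr s * (cmod (a n))\<^sup>2) \<le>
        (2 powr \<bar>s\<bar> * C\<^sup>2) * real n powr (2 * s - 2 * p)" by simp
  qed
  then show ?thesis using assms(1) by (auto simp: zonal_sobolev_def s_def)
qed

theorem theorem1p6:
  fixes d :: nat and p C :: real and e :: "'a::euclidean_space"
    and a :: "nat \<Rightarrow> complex" and f :: "'a \<Rightarrow> complex"
  assumes "d \<ge> 2" and "DIM('a) = d + 1" and "e \<in> sphere 0 1"
    and "(real d + 1) / 2 < p" and "p < (real d + 2) / 2"
    and "\<And>n. n \<ge> 1 \<Longrightarrow> cmod (a n) \<le> C / real n powr p"
    and "\<And>n. n \<ge> 1 \<Longrightarrow> cmod (a n - a (n - 1)) \<le> C / real n powr (p + 1)"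
    and "zonal_expansion e a f"
  shows "(\<forall>\<epsilon>>0. f \<in> zonal_sobolev e (p - 1 / 2 - \<epsilon>)) \<and>
    (\<forall>\<mu> s T u. \<mu> \<in> {1, -1} \<and> s > real d / 2 \<and> T > 0 \<and> nls_solution e \<mu> s T f u \<longrightarrow>
      (AE t in lborel. t \<in> {0<..<T} \<longrightarrow>
         fractal_dim (sphere_graph (\<lambda>x. Re (u t x))) \<le> ereal ((real d + 1) - (p - real d / 2)) \<and>
         fractal_dim (sphere_graph (\<lambda>x. Im (u t x))) \<le> ereal ((real d + 1) - (p - real d / 2))))"
proof (intro conjI allI impI)
  show "f \<in> zonal_sobolev e (p - 1 / 2 - \<epsilon>)" if "\<epsilon> > 0" for \<epsilon>
    using assms(6,8) that by (intro zonal_sobolev_of_decay)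
next
  fix \<mu> s T :: real and u
  assume *: "\<mu> \<in> {1, -1} \<and> s > real d / 2 \<and> T > 0 \<and> nls_solution e \<mu> s T f u"
  have e: "norm e = 1" "d \<ge> 1" using assms(1,3) by auto
  have s: "1 \<le> s" using * assms(1) by auto
  have D: "real d < (real d + 1) - (p - real d / 2)" using assms(5) by (simp add: field_simps)
  have "fractal_dim (sphere_graph (\<lambda>x. part (u t x))) \<le> ereal ((real d + 1) - (p - real d / 2))"
    if "t \<in> {0<..<T}" "part = Re \<or> part = Im" for t part
  proof (rule fractal_dim_sphere_graph_le[OF e(1) assms(2) e(2) s _ _ that(2) D])
    have "t \<in> {0..<T}" using that(1) by auto
    then show "u t \<in> zonal_sobolev e s" "continuous_on (sphere 0 1) (u t)"
      using * by (auto simp: nls_solution_def)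
  qed
  then show "AE t in lborel. t \<in> {0<..<T} \<longrightarrow>
      fractal_dim (sphere_graph (\<lambda>x. Re (u t x))) \<le> ereal ((real d + 1) - (p - real d / 2)) \<and>
      fractal_dim (sphere_graph (\<lambda>x. Im (u t x))) \<le> ereal ((real d + 1) - (p - real d / 2))"
    by (intro AE_I2) blast
qed

end
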